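(* Let $\ell\ge1$ be an integer and $a\in\mathbb C^*$. The $\mathcal U_q(\hat{sl}_\infty)$-module $V(Y_{\ell,a}Y_{0,aq^\ell}^{-1})$ is thin, and $$\chi_q(V(Y_{\ell,a}Y_{0,aq^\ell}^{-1}))=\sum_{T\in\mathcal T_{[1,\ell]}}m_T,\qquad m_T=\prod_{1\le j\le\ell}\boxed{i_j}_{aq^{\ell+1-2j}}\ \text{ for }T=(i_1<\cdots<i_\ell),$$ where $\mathcal T_{[1,\ell]}$ is the set of strictly increasing integer sequences of length $\ell$ and $\boxed{j}_b=Y_{j-1,bq^j}^{-1}Y_{j,bq^{j-1}}$ for $j\in\mathbb Z$, $b\in\mathbb C^*$.
   Context: Algebra. Fix $t\in\mathbb C$ such that $q=e^{t}$ is not a root of unity, and put $q^{r}=e^{tr}$ for $r\in\mathbb Q$. For $i,j\in\mathbb Z$ let $C_{ii}=2$, $C_{i,i\pm1}=-1$, $C_{ij}=0$ otherwise; $\mathfrak h=\bigoplus_{i\in\mathbb Z}\mathbb Q h_i$; $\Lambda_i\in\mathfrak h^*$ with $\Lambda_i(h_j)=\delta_{ij}$; $\alpha_i=2\Lambda_i-\Lambda_{i-1}-\Lambda_{i+1}$. The algebra $\mathcal U_q(\hat{sl}_\infty)$ is the $\mathbb C$-algebra generated by $x_{i,r}^{\pm}$ ($i,r\in\mathbb Z$), $k_h$ ($h\in\mathfrak h$), $h_{i,m}$ ($i\in\mathbb Z$, $m\in\mathbb Z\setminus\{0\}$). With $x_i^\pm(z)=\sum_{r}x_{i,r}^\pm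 z^r$, $\phi_i^\pm(z)=\sum_{m\ge0}\phi^\pm_{i,\pm m}z^{\pm m}=k_{\pm h_i}\exp(\pm(q-q^{-1})\sum_{m\ge1}h_{i,\pm m}z^{\pm m})$, $\delta(z)=\sum_{s\in\mathbb Z}z^s$, the relations are: $k_hk_{h'}=k_{h+h'}$, $k_0=1$; all $k_h$ and all coefficients of the $\phi_i^\pm(z)$ commute; $k_hx_j^\pm(z)k_{-h}=q^{\pm\alpha_j(h)}x_j^\pm(z)$; for $\epsilon\in\{+,-\}$, $(w-q^{\pm C_{ij}}z)\phi_i^{\epsilon}(z)x_j^\pm(w)=(q^{\pm C_{ij}}w-z)x_j^\pm(w)\phi_i^{\epsilon}(z)$; $[x_i^+(z),x_j^-(w)]=\frac{\delta_{ij}}{q-q^{-1}}\big(\delta(w/z)\phi_i^+(w)-\delta(z/w)\phi_i^-(z)\big)$; $(w-q^{\pm C_{ij}}z)x_i^\pm(z)x_j^\pm(w)=(q^{\pm C_{ij}}w-z)x_j^\pm(w)x_i^\pm(z)$; for $|i-j|=1$, $x_i^\pm(z_1)x_i^\pm(z_2)x_j^\pm(w)-(q+q^{-1})x_i^\pm(z_1)x_j^\pm(w)x_i^\pm(z_2)+x_j^\pm(w)x_i^\pm(z_1)x_i^\pm(z_2)+(z_1\leftrightarrow z_2)=0$; and $[x_i^\pm(z),x_j^\pm(w)]=0$ for $|i-j|\ge2$. The Cartan subalgebra $\mathcal U_q(\hat{\mathfrak h})$ is generated by the $k_h$ and $h_{i,m}$. Fundamental modules. Put $\psi(z)=\frac{q-q^{-1}z}{1-z}$.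 Let $\mathcal T_\ell^+$ be the set of strictly increasing integer sequences $T=(\cdots<i_{\ell-1}<i_\ell)$ indexed by $p\le\ell$ with $i_p=p$ for $p\ll0$; $\mathcal T_0^-$ the set of strictly increasing sequences $T=(i_{1}<i_{2}<\cdots)$ indexed by $p\ge1$ with $i_p=p$ for $p\gg0$. $\tilde e_iT$ is obtained by replacing the entry $i+1$ by $i$ ($0$ if $i+1\notin T$ or $i\in T$), $\tilde f_iT$ by replacing $i$ by $i+1$ ($0$ if $i\notin T$ or $i+1\in T$). The fundamental modules $V(Y_{\ell,b})$ and $V(Y_{0,b}^{-1})$, $b\in\mathbb C^*$, have bases $\{T_b\}$ indexed by $\mathcal T_\ell^+$, respectively $\mathcal T_0^-$, with action (put $N=\ell$, respectively $N=0$; $0_b=0$; rational functions expanded in $z^{\pm1}$ for $\phi_i^\pm$): $x_i^+(z)T_b=\sum_p\delta_{\{i_p=i+1\}}\delta(bq^{i+N+1-2p}z)(\tilde e_iT)_b$; $x_i^-(z)T_b=\sum_p\delta_{\{i_p=i\}}\delta(bq^{i+N+1-2p}z)(\tilde f_iT)_b$; $\phi_i^\pm(z)T_b=\psi(bq^{i+N+3-2p}z)^{-1}T_b$ if $i_p=i+1$ for some $p$ and $i\notin T$; $=\psi(bq^{i+N+1-2p}z)T_b$ if $i_p=i$ for some $p$ and $i+1\notin T$; $=T_b$ otherwise. The module. $V(Y_{\ell,a})\otimes V(Y_{0,aq^\ell}^{-1})$ is a module via the Drinfeld coproduct $\Delta(x_i^+(z))=x_i^+(z)\otimes1+\phi_i^-(z)\otimes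 x_i^+(z)$, $\Delta(x_i^-(z))=x_i^-(z)\otimes\phi_i^+(z)+1\otimes x_i^-(z)$, $\Delta(\phi_i^\pm(z))=\phi_i^\pm(z)\otimes\phi_i^\pm(z)$, where a product of a rational function $f(z)$ and $\delta(cz)$ is understood as $f(c^{-1})\delta(cz)$. For $T=(i_p)_{p\le\ell}\in\mathcal T_\ell^+$ put $\alpha_T=\sup\{p\le\ell: i_p=p\}$; for $T'=(j_p)_{p\ge1}\in\mathcal T_0^-$ put $\beta_{T'}=\inf\{p\ge1: j_p=p\}$. $V(Y_{\ell,a}Y_{0,aq^\ell}^{-1})$ is the submodule spanned by the $T_a\otimes T'_{aq^\ell}$ with $T\in\mathcal T_\ell^+$, $T'\in\mathcal T_0^-$, $\alpha_T\ge\beta_{T'}-1$. Definitions. For a monomial $m=\prod Y_{i,b}^{u_{i,b}}$ (finite product), $V_m$ is the simultaneous generalized eigenspace on which $\phi_i^\pm(z)$ has generalized eigenvalue the expansion in $z^{\pm1}$ of $\prod_b\psi(bqz)^{u_{i,b}}$ for every $i\in\mathbb Z$; $\chi_q(V)=\sum_m\dim(V_m)\,m$. A module is thin if $\mathcal U_q(\hat{\mathfrak h})$ acts by diagonalizable operators with simple joint spectrum. *)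

theory Defs
  imports
    Complex_Main
    "HOL-Library.FuncSet"
    "HOL-Library.Poly_Mapping"
    "HOL-Library.Extended_Nat"
    "HOL-Computational_Algebra.Formal_Power_Series"
    "HOL-Computational_Algebra.Formal_Laurent_Series"
begin

section \<open>Cartan data\<close>

datatype sign = Plus | Minus

primrec sg :: "sign \<Rightarrow> int" where
  "sg Plus = 1"
| "sg Minus = - 1"

definition cartan :: "int \<Rightarrow> int \<Rightarrow> int" where
  "cartan i j = (if i = j then 2 else if \<bar>i - j\<bar> = 1 then - 1 else 0)"

text \<open>The rational vector space with basis \<open>h\<^sub>i\<close>: \<open>h\<^sub>i\<close> is \<open>Poly_Mapping.single i 1\<close>.\<close>

type_synonym hspace = "int \<Rightarrow>\<^sub>0 rat"

definition Lam :: "int \<Rightarrow> hspace \<Rightarrow> rat" where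
  "Lam i h = Poly_Mapping.lookup h i"

definition alpha :: "int \<Rightarrow> hspace \<Rightarrow> rat" where
  "alpha i h = 2 * Lam i h - Lam (i - 1) h - Lam (i + 1) h"

definition qpow :: "complex \<Rightarrow> rat \<Rightarrow> complex" where
  "qpow t r = exp (t * of_rat r)"

section \<open>Representations of the quantum affinization\<close>

text \<open>
  A module over an algebra given by generators and relations is a vector space with an operator
  for every generator, satisfying the relations. \<open>Xop s i r\<close> is the action of
  \<open>x\<^sup>s\<^bsub>i,r\<^esub>\<close>, \<open>Kop h\<close> that of \<open>k\<^sub>h\<close>, and \<open>Hop i m\<close> that of \<open>h\<^bsub>i,m\<^esub>\<close>; there is no generator
  \<open>h\<^bsub>i,0\<^esub>\<close>, and \<open>Hop i 0\<close> is never used. The underlying space is a subspace \<open>Vsp\<close> of the ambient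
  type, and what the operators do outside of it is irrelevant.
\<close>

record 'v uq_data =
  Vsp :: "'v set"
  Xop :: "sign \<Rightarrow> int \<Rightarrow> int \<Rightarrow> 'v \<Rightarrow> 'v"
  Kop :: "hspace \<Rightarrow> 'v \<Rightarrow> 'v"
  Hop :: "int \<Rightarrow> int \<Rightarrow> 'v \<Rightarrow> 'v"

text \<open>
  \<open>series_pow A k n\<close> is the coefficient of \<open>u\<^sup>n\<close> in the \<open>k\<close>-th power of the operator-valued
  series \<open>\<Sum>m\<ge>1. A m u\<^sup>m\<close>. As this series has no constant term, only the powers
  \<open>k \<le> n\<close> contribute to the coefficient of \<open>u\<^sup>n\<close> in its exponential.
\<close>

primrec series_pow ::
  "(nat \<Rightarrow> 'v::ab_group_add \<Rightarrow> 'v) \<Rightarrow> nat \<Rightarrow> nat \<Rightarrow> 'v \<Rightarrow> 'v" where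
  "series_pow A 0 n v = (if n = 0 then v else 0)"
| "series_pow A (Suc k) n v = (\<Sum>m = 1..n. A m (series_pow A k (n - m) v))"

text \<open>
  Monomials in the \<open>Y\<^bsub>i,b\<^esub>\<close> form a multiplicative group, written additively here: a monomial
  is its finitely supported exponent function \<open>(i, b) \<mapsto> u\<^bsub>i,b\<^esub>\<close>.
\<close>

type_synonym ymonom = "(int \<times> complex) \<Rightarrow>\<^sub>0 int"

definition Yvar :: "int \<Rightarrow> complex \<Rightarrow> ymonom" where
  "Yvar i b = Poly_Mapping.single (i, b) 1"

definition ymonoms :: "ymonom set" where
  "ymonoms = {m. \<forall>(i, b) \<in> Poly_Mapping.keys m. b \<noteq> 0}"

text \<open>
  Rational functions of \<open>z\<close> are needed in three guises: as functions on the complex numbers, and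
  expanded in powers of \<open>z\<close> or of \<open>z\<inverse>\<close>. They are therefore written as expressions over an
  arbitrary field with an embedding \<open>\<iota>\<close> of the complex numbers and an element \<open>z\<close>. Taking the
  field of formal Laurent series, with \<open>z\<close> the variable or its inverse, gives the two
  expansions; in the second case the variable of the Laurent series stands for \<open>z\<inverse>\<close>.
\<close>

definition psi :: "'a::field \<Rightarrow> 'a \<Rightarrow> 'a" where
  "psi q z = (q - inverse q * z) / (1 - z)"

primrec zvar :: "sign \<Rightarrow> complex fls" where
  "zvar Plus = fls_X"
| "zvar Minus = fls_X_inv"

definition lweight :: "(complex \<Rightarrow> 'a::field) \<Rightarrow> 'a \<Rightarrow> complex \<Rightarrow> ymonom \<Rightarrow> int \<Rightarrow> 'a" where
  "lweight \<iota> z q m i =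
     (\<Prod>b \<in> {b. (i, b) \<in> Poly_Mapping.keys m}.
        psi (\<iota> q) (\<iota> (b * q) * z) powi Poly_Mapping.lookup m (i, b))"

locale uq_rep = vector_space scale
  for scale :: "complex \<Rightarrow> 'v::ab_group_add \<Rightarrow> 'v" +
  fixes t :: complex and M :: "'v uq_data"
begin

abbreviation q :: complex where "q \<equiv> exp t"

text \<open>\<open>phi s i n\<close> is \<open>\<phi>\<^sup>s\<^bsub>i,s n\<^esub>\<close>, the coefficient of \<open>z\<^bsup>s n\<^esup>\<close> in \<open>\<phi>\<^sup>s\<^sub>i(z)\<close>.\<close>

definition phi :: "sign \<Rightarrow> int \<Rightarrow> nat \<Rightarrow> 'v \<Rightarrow> 'v" where
  "phi s i n v =
     Kop M (Poly_Mapping.single i (of_int (sg s)))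
       (\<Sum>k\<le>n. scale (1 / fact k)
          (series_pow
             (\<lambda>m u. scale (of_int (sg s) * (q - inverse q)) (Hop M i (sg s * int m) u)) k n v))"

text \<open>\<open>phiz s i r\<close> is the coefficient of \<open>z\<^sup>r\<close> in \<open>\<phi>\<^sup>s\<^sub>i(z)\<close>, for an arbitrary integer \<open>r\<close>.\<close>

definition phiz :: "sign \<Rightarrow> int \<Rightarrow> int \<Rightarrow> 'v \<Rightarrow> 'v" where
  "phiz s i r v = (if 0 \<le> sg s * r then phi s i (nat (sg s * r)) v else 0)"

text \<open>The operators through which the Cartan subalgebra acts.\<close>

inductive_set cartan_ops :: "('v \<Rightarrow> 'v) set" where
  one: "(\<lambda>v. v) \<in> cartan_ops"
| K: "Kop M h \<in> cartan_ops"
| H: "m \<noteq> 0 \<Longrightarrow> Hop M i m \<in> cartan_ops"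
| scale: "A \<in> cartan_ops \<Longrightarrow> (\<lambda>v. scale c (A v)) \<in> cartan_ops"
| add: "A \<in> cartan_ops \<Longrightarrow> B \<in> cartan_ops \<Longrightarrow> (\<lambda>v. A v + B v) \<in> cartan_ops"
| mult: "A \<in> cartan_ops \<Longrightarrow> B \<in> cartan_ops \<Longrightarrow> (\<lambda>v. A (B v)) \<in> cartan_ops"

definition joint_eigenspace :: "(('v \<Rightarrow> 'v) \<Rightarrow> complex) \<Rightarrow> 'v set" where
  "joint_eigenspace \<chi> = {v \<in> Vsp M. \<forall>A \<in> cartan_ops. A v = scale (\<chi> A) v}"

text \<open>
  Simplicity of the joint spectrum is not stated as \<open>dim \<le> 1\<close>, because \<open>dim\<close> is \<open>0\<close> for
  infinite-dimensional spaces.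
\<close>

definition thin :: bool where
  "thin \<longleftrightarrow>
     span (\<Union>\<chi>. joint_eigenspace \<chi>) = Vsp M \<and>
     (\<forall>\<chi>. \<exists>v. joint_eigenspace \<chi> \<subseteq> span {v})"

definition edim :: "'v set \<Rightarrow> enat" where
  "edim S = (if \<exists>B. finite B \<and> S \<subseteq> span B then enat (dim S) else \<infinity>)"

definition gen_eigenspace :: "ymonom \<Rightarrow> 'v set" where
  "gen_eigenspace m =
     {v \<in> Vsp M. \<forall>s i n. \<exists>k.
        ((\<lambda>u. phi s i n u - scale (fls_nth (lweight fls_const (zvar s) q m i) (int n)) u) ^^ k) v
          = 0}"

text \<open>The formal sum \<open>\<chi>\<^sub>q(V)\<close>, as the function sending a monomial to its coefficient.\<close>

definition qchar :: "ymonom \<Rightarrow> enat" where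
  "qchar m = (if m \<in> ymonoms then edim (gen_eigenspace m) else 0)"

end

text \<open>
  The defining relations, read off coefficientwise from the relations between generating series.
  The comparison is between the coefficients of \<open>z\<^sup>m w\<^sup>r\<close> in \<open>phi_X\<close>, of \<open>z\<^sup>r w\<^sup>p\<close> in
  \<open>X_X\<close>, \<open>X_comm\<close> and \<open>XP_XM\<close>, and of \<open>z\<^sub>1\<^sup>r z\<^sub>2\<^sup>p w\<^sup>n\<close> in \<open>serre\<close>.
\<close>

locale uq_module = uq_rep +
  assumes subsp: "subspace (Vsp M)"
    and X_closed: "\<And>s i r v. v \<in> Vsp M \<Longrightarrow> Xop M s i r v \<in> Vsp M"
    and K_closed: "\<And>h v. v \<in> Vsp M \<Longrightarrow> Kop M h v \<in> Vsp M"
    and H_closed: "\<And>i m v. m \<noteq> 0 \<Longrightarrow> v \<in> Vsp M \<Longrightarrow> Hop M i m v \<in> Vsp M"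
    and X_linear: "\<And>s i r c u v. u \<in> Vsp M \<Longrightarrow> v \<in> Vsp M \<Longrightarrow>
          Xop M s i r (scale c u + v) = scale c (Xop M s i r u) + Xop M s i r v"
    and K_linear: "\<And>h c u v. u \<in> Vsp M \<Longrightarrow> v \<in> Vsp M \<Longrightarrow>
          Kop M h (scale c u + v) = scale c (Kop M h u) + Kop M h v"
    and H_linear: "\<And>i m c u v. m \<noteq> 0 \<Longrightarrow> u \<in> Vsp M \<Longrightarrow> v \<in> Vsp M \<Longrightarrow>
          Hop M i m (scale c u + v) = scale c (Hop M i m u) + Hop M i m v"
    and K_K: "\<And>h h' v. v \<in> Vsp M \<Longrightarrow> Kop M h (Kop M h' v) = Kop M (h + h') v"
    and K_0: "\<And>v. v \<in> Vsp M \<Longrightarrow> Kop M 0 v = v"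
    and K_phi: "\<And>h s i n v. v \<in> Vsp M \<Longrightarrow> Kop M h (phi s i n v) = phi s i n (Kop M h v)"
    and phi_phi: "\<And>s i n s' j p v. v \<in> Vsp M \<Longrightarrow>
          phi s i n (phi s' j p v) = phi s' j p (phi s i n v)"
    and K_X: "\<And>h s j r v. v \<in> Vsp M \<Longrightarrow>
          Kop M h (Xop M s j r (Kop M (- h) v)) =
          scale (qpow t (of_int (sg s) * alpha j h)) (Xop M s j r v)"
    and phi_X: "\<And>e s i j m r v. v \<in> Vsp M \<Longrightarrow>
          phiz e i m (Xop M s j (r - 1) v)
            - scale (q powi (sg s * cartan i j)) (phiz e i (m - 1) (Xop M s j r v)) =
          scale (q powi (sg s * cartan i j)) (Xop M s j (r - 1) (phiz e i m v))
            - Xop M s j r (phiz e i (m - 1) v)"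
    and XP_XM: "\<And>i j r p v. v \<in> Vsp M \<Longrightarrow>
          Xop M Plus i r (Xop M Minus j p v) - Xop M Minus j p (Xop M Plus i r v) =
          (if i = j
           then scale (1 / (q - inverse q)) (phiz Plus i (r + p) v - phiz Minus i (r + p) v)
           else 0)"
    and X_X: "\<And>s i j r p v. v \<in> Vsp M \<Longrightarrow>
          Xop M s i r (Xop M s j (p - 1) v)
            - scale (q powi (sg s * cartan i j)) (Xop M s i (r - 1) (Xop M s j p v)) =
          scale (q powi (sg s * cartan i j)) (Xop M s j (p - 1) (Xop M s i r v))
            - Xop M s j p (Xop M s i (r - 1) v)"
    and serre: "\<And>s i j r p n v. \<bar>i - j\<bar> = 1 \<Longrightarrow> v \<in> Vsp M \<Longrightarrow>
          (Xop M s i r (Xop M s i p (Xop M s j n v))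
            - scale (q + inverse q) (Xop M s i r (Xop M s j n (Xop M s i p v)))
            + Xop M s j n (Xop M s i r (Xop M s i p v)))
          + (Xop M s i p (Xop M s i r (Xop M s j n v))
            - scale (q + inverse q) (Xop M s i p (Xop M s j n (Xop M s i r v)))
            + Xop M s j n (Xop M s i p (Xop M s i r v))) = 0"
    and X_comm: "\<And>s i j r p v. \<bar>i - j\<bar> \<ge> 2 \<Longrightarrow> v \<in> Vsp M \<Longrightarrow>
          Xop M s i r (Xop M s j p v) = Xop M s j p (Xop M s i r v)"

section \<open>Finitely supported vectors\<close>

definition fscale :: "complex \<Rightarrow> ('b \<Rightarrow>\<^sub>0 complex) \<Rightarrow> ('b \<Rightarrow>\<^sub>0 complex)" where
  "fscale c v = Poly_Mapping.map (\<lambda>x. c * x) v"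

definition bvec :: "'b \<Rightarrow> ('b \<Rightarrow>\<^sub>0 complex)" where
  "bvec B = Poly_Mapping.single B 1"

definition lin_ext :: "('b \<Rightarrow> ('c \<Rightarrow>\<^sub>0 complex)) \<Rightarrow> ('b \<Rightarrow>\<^sub>0 complex) \<Rightarrow> ('c \<Rightarrow>\<^sub>0 complex)" where
  "lin_ext f v = (\<Sum>B \<in> Poly_Mapping.keys v. fscale (Poly_Mapping.lookup v B) (f B))"

text \<open>The tensor product of the spaces with bases \<open>'b\<close> and \<open>'c\<close> has basis \<open>'b \<times> 'c\<close>.\<close>

definition tens ::
  "('b \<Rightarrow>\<^sub>0 complex) \<Rightarrow> ('c \<Rightarrow>\<^sub>0 complex) \<Rightarrow> (('b \<times> 'c) \<Rightarrow>\<^sub>0 complex)" where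
  "tens u v =
     (\<Sum>B \<in> Poly_Mapping.keys u. \<Sum>C \<in> Poly_Mapping.keys v.
        fscale (Poly_Mapping.lookup u B * Poly_Mapping.lookup v C) (bvec (B, C)))"

section \<open>Fundamental modules\<close>

text \<open>
  A sequence indexed by a set \<open>D\<close> of integers is an extensional function on \<open>D\<close>. For the index
  set \<open>D\<close> we use \<open>{..\<ell>}\<close> (with \<open>N = \<ell>\<close>) for \<open>V(Y\<^bsub>\<ell>,b\<^esub>)\<close>, and \<open>{1..}\<close> (with \<open>N = 0\<close>) for
  \<open>V(Y\<^bsub>0,b\<^esub>\<inverse>)\<close>.
\<close>

type_synonym iseq = "int \<Rightarrow> int"

definition seqs_plus :: "int \<Rightarrow> iseq set" where
  "seqs_plus l =
     {T \<in> extensional {..l}. strict_mono_on {..l} T \<and> (\<forall>\<^sub>F p in at_bot. T p = p)}"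

definition seqs_minus :: "iseq set" where
  "seqs_minus =
     {T \<in> extensional {1..}. strict_mono_on {1..} T \<and> (\<forall>\<^sub>F p in at_top. T p = p)}"

definition seqs_fin :: "int \<Rightarrow> iseq set" where
  "seqs_fin l = {T \<in> extensional {1..l}. strict_mono_on {1..l} T}"

text \<open>
  \<open>x\<^sup>+\<^sub>i\<close> replaces the entry \<open>i + 1\<close> by \<open>i\<close>, and \<open>x\<^sup>-\<^sub>i\<close> replaces the entry \<open>i\<close> by \<open>i + 1\<close>.
\<close>

primrec entry_from :: "sign \<Rightarrow> int \<Rightarrow> int" where
  "entry_from Plus i = i + 1"
| "entry_from Minus i = i"

primrec entry_to :: "sign \<Rightarrow> int \<Rightarrow> int" where
  "entry_to Plus i = i"
| "entry_to Minus i = i + 1"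

text \<open>\<open>crystal_op D Plus i\<close> is \<open>e\<^sub>i\<close> and \<open>crystal_op D Minus i\<close> is \<open>f\<^sub>i\<close> (Kashiwara
  operators), as a vector because the result may be \<open>0\<close>.\<close>

definition crystal_op :: "int set \<Rightarrow> sign \<Rightarrow> int \<Rightarrow> iseq \<Rightarrow> (iseq \<Rightarrow>\<^sub>0 complex)" where
  "crystal_op D s i T =
     (if entry_from s i \<notin> T ` D \<or> entry_to s i \<in> T ` D then 0
      else bvec (\<lambda>p\<in>D. if T p = entry_from s i then entry_to s i else T p))"

definition index_of :: "int set \<Rightarrow> iseq \<Rightarrow> int \<Rightarrow> int" where
  "index_of D T x = (THE p. p \<in> D \<and> T p = x)"

text \<open>The eigenvalue of \<open>\<phi>\<^sup>\<plusminus>\<^sub>i(z)\<close> on \<open>T\<^sub>b\<close>, as a rational function of \<open>z\<close>.\<close>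

definition fund_phi ::
  "(complex \<Rightarrow> 'a::field) \<Rightarrow> 'a \<Rightarrow> complex \<Rightarrow> int set \<Rightarrow> int \<Rightarrow> complex \<Rightarrow> int \<Rightarrow> iseq \<Rightarrow> 'a" where
  "fund_phi \<iota> z q D N b i T =
     (if i + 1 \<in> T ` D \<and> i \<notin> T ` D
      then inverse (psi (\<iota> q) (\<iota> (b * q powi (i + N + 3 - 2 * index_of D T (i + 1))) * z))
      else if i \<in> T ` D \<and> i + 1 \<notin> T ` D
      then psi (\<iota> q) (\<iota> (b * q powi (i + N + 1 - 2 * index_of D T i)) * z)
      else 1)"

text \<open>
  The coefficient of \<open>z\<^sup>r\<close> in \<open>g(z) x\<^sup>s\<^sub>i(z) T\<^sub>b\<close>, where \<open>g(z) \<delta>(c z)\<close> is \<open>g(c\<inverse>) \<delta>(c z)\<close>.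
  For \<open>g = 1\<close> this is the action of \<open>x\<^sup>s\<^bsub>i,r\<^esub>\<close> on the fundamental module.
\<close>

definition fund_x ::
  "complex \<Rightarrow> int set \<Rightarrow> int \<Rightarrow> complex \<Rightarrow> (complex \<Rightarrow> complex) \<Rightarrow> sign \<Rightarrow> int \<Rightarrow> int \<Rightarrow> iseq
     \<Rightarrow> (iseq \<Rightarrow>\<^sub>0 complex)" where
  "fund_x q D N b g s i r T =
     (\<Sum>p \<in> {p \<in> D. T p = entry_from s i}.
        let c = b * q powi (i + N + 1 - 2 * p)
        in fscale (g (inverse c) * c powi r) (crystal_op D s i T))"

text \<open>
  \<open>T\<^sub>b\<close> is a weight vector; its weight takes the value \<open>\<plusminus>1\<close> or \<open>0\<close> on \<open>h\<^sub>i\<close>, with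
  \<open>k\<^bsub>\<plusminus>h\<^sub>i\<^esub>\<close> acting as the constant term of \<open>\<phi>\<^sup>\<plusminus>\<^sub>i(z)\<close>, and \<open>k\<^sub>h\<close> acts as \<open>q\<close> to the value on \<open>h\<close>.
\<close>

definition fund_wt :: "int set \<Rightarrow> iseq \<Rightarrow> hspace \<Rightarrow> rat" where
  "fund_wt D T h =
     (\<Sum>i \<in> Poly_Mapping.keys h. Poly_Mapping.lookup h i *
        (if i + 1 \<in> T ` D \<and> i \<notin> T ` D then - 1
         else if i \<in> T ` D \<and> i + 1 \<notin> T ` D then 1 else 0))"

section \<open>The tensor product module and its submodule\<close>

text \<open>
  The eigenvalue of \<open>h\<^bsub>i,m\<^esub>\<close> (\<open>m \<noteq> 0\<close>) on a vector on which \<open>\<phi>\<^sup>s\<^sub>i(z)\<close> has eigenvalue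
  \<open>F s\<close>: it is forced by
  \<open>F s = F s 0 * exp (s (q - q\<inverse>) \<Sum>n\<ge>1. h\<^bsub>i,s n\<^esub> z\<^bsup>s n\<^esup>)\<close>, solved with
  \<open>fps_ln 1 = log (1 + X)\<close>.
\<close>

definition h_eigenvalue :: "complex \<Rightarrow> (sign \<Rightarrow> complex fls) \<Rightarrow> int \<Rightarrow> complex" where
  "h_eigenvalue q F m =
     (let s = (if 0 < m then Plus else Minus);
          f = fls_regpart (F s)
      in of_int (sg s) / (q - inverse q) *
         fps_nth (fps_ln 1 oo (fps_const (inverse (fps_nth f 0)) * f - 1)) (nat \<bar>m\<bar>))"

text \<open>
  \<open>V(Y\<^bsub>\<ell>,a\<^esub>) \<otimes> V(Y\<^bsub>0,aq\<^sup>\<ell>\<^esub>\<inverse>)\<close> with the Drinfeld coproduct; \<open>(T, T')\<close> is the basis element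
  \<open>T\<^sub>a \<otimes> T'\<^bsub>aq\<^sup>\<ell>\<^esub>\<close>. The rational functions in \<open>tens_x\<close> are never evaluated at a pole:
  a pole would need \<open>i\<^sub>p, j\<^sub>p \<in> {i, i + 1}\<close> for one and the same index \<open>p\<close>, and this is
  excluded by \<open>j\<^sub>p \<le> p \<le> i\<^sub>p\<close> together with the conditions on the other entries. At the pole
  \<open>u = 1\<close> of \<open>\<psi>(u)\<close> the function \<open>\<psi>(u)\<inverse>\<close> has a zero, and \<open>inverse (psi q 1) = 0\<close> does give
  that value.
\<close>

definition tens_phi ::
  "(complex \<Rightarrow> 'a::field) \<Rightarrow> 'a \<Rightarrow> complex \<Rightarrow> int \<Rightarrow> complex \<Rightarrow> int \<Rightarrow> iseq \<times> iseq \<Rightarrow> 'a" where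
  "tens_phi \<iota> z q l a i = (\<lambda>(T, T').
     fund_phi \<iota> z q {..l} l a i T * fund_phi \<iota> z q {1..} 0 (a * q powi l) i T')"

fun tens_x ::
  "complex \<Rightarrow> int \<Rightarrow> complex \<Rightarrow> sign \<Rightarrow> int \<Rightarrow> int \<Rightarrow> iseq \<times> iseq
     \<Rightarrow> ((iseq \<times> iseq) \<Rightarrow>\<^sub>0 complex)" where
  "tens_x q l a Plus i r (T, T') =
     tens (fund_x q {..l} l a (\<lambda>_. 1) Plus i r T) (bvec T') +
     tens (bvec T)
       (fund_x q {1..} 0 (a * q powi l) (\<lambda>z. fund_phi (\<lambda>c. c) z q {..l} l a i T) Plus i r T')"
| "tens_x q l a Minus i r (T, T') =
     tens (fund_x q {..l} l a
             (\<lambda>z. fund_phi (\<lambda>c. c) z q {1..} 0 (a * q powi l) i T') Minus i r T) (bvec T') +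
     tens (bvec T) (fund_x q {1..} 0 (a * q powi l) (\<lambda>_. 1) Minus i r T')"

definition tensor_module ::
  "complex \<Rightarrow> int \<Rightarrow> complex \<Rightarrow> ((iseq \<times> iseq) \<Rightarrow>\<^sub>0 complex) uq_data" where
  "tensor_module t l a =
     \<lparr>Vsp = module.span fscale (bvec ` (seqs_plus l \<times> seqs_minus)),
      Xop = (\<lambda>s i r. lin_ext (tens_x (exp t) l a s i r)),
      Kop = (\<lambda>h. lin_ext (\<lambda>(T, T').
               fscale (qpow t (fund_wt {..l} T h) * qpow t (fund_wt {1..} T' h)) (bvec (T, T')))),
      Hop = (\<lambda>i m. lin_ext (\<lambda>B.
               fscale (h_eigenvalue (exp t) (\<lambda>s. tens_phi fls_const (zvar s) (exp t) l a i B) m)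
                 (bvec B)))\<rparr>"

definition alpha_idx :: "int \<Rightarrow> iseq \<Rightarrow> int" where
  "alpha_idx l T = Sup {p. p \<le> l \<and> T p = p}"

definition beta_idx :: "iseq \<Rightarrow> int" where
  "beta_idx T' = Inf {p. 1 \<le> p \<and> T' p = p}"

text \<open>\<open>V(Y\<^bsub>\<ell>,a\<^esub> Y\<^bsub>0,aq\<^sup>\<ell>\<^esub>\<inverse>)\<close>.\<close>

definition V_YY ::
  "complex \<Rightarrow> int \<Rightarrow> complex \<Rightarrow> ((iseq \<times> iseq) \<Rightarrow>\<^sub>0 complex) uq_data" where
  "V_YY t l a =
     (tensor_module t l a)
       \<lparr>Vsp := module.span fscale
          {bvec (T, T') | T T'.
             T \<in> seqs_plus l \<and> T' \<in> seqs_minus \<and> alpha_idx l T \<ge> beta_idx T' - 1}\<rparr>"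

section \<open>The monomials of the character formula\<close>

definition box :: "complex \<Rightarrow> int \<Rightarrow> complex \<Rightarrow> ymonom" where
  "box q j b = - Yvar (j - 1) (b * q powi j) + Yvar j (b * q powi (j - 1))"

definition mT :: "complex \<Rightarrow> int \<Rightarrow> complex \<Rightarrow> iseq \<Rightarrow> ymonom" where
  "mT q l a T = (\<Sum>j = 1..l. box q (T j) (a * q powi (l + 1 - 2 * j)))"

text \<open>The formal sum \<open>\<Sum>x\<in>A. f x\<close> of monomials, as the function sending a monomial to its
  coefficient.\<close>

definition formal_sum :: "'x set \<Rightarrow> ('x \<Rightarrow> ymonom) \<Rightarrow> ymonom \<Rightarrow> enat" where
  "formal_sum A f m =
     (if finite {x \<in> A. f x = m} then enat (card {x \<in> A. f x = m}) else \<infinity>)"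

end

(*
  For a strictly increasing sequence S of length l put T p = max (S p) p and T' p = min (S p) p,
  extended by the identity to the indices p <= 0 and p > l respectively. The pairs (T, T') are exactly
  the basis of the submodule, and in terms of the finite set A = {S 1, ..., S l} the action is that
  of a finite version of a fundamental module: x_i^+ and x_i^- exchange i + 1 and i with the spectral
  parameter c = a q^(l + i - 1 - 2 n), n being the number of elements of A below i, and phi_i acts by
  psi(c z), psi(c q^2 z)^(-1) or 1. The relations become identities between these scalars. The k_h
  alone separate the basis vectors because A is finite and q is not a root of unity, so the module
  is thin. The l-weight of A is that of the monomial m_S, and monomials are determined by their
  l-weights, again because q is not a root of unity.
*)
theory Submission
  imports Defs "HOL-Computational_Algebra.Polynomial_FPS"
begin

text \<open>The condition \<open>alpha_idx l T \<ge> beta_idx T' - 1\<close> says that at every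
  index p from 1 to l at least one of T p, T' p equals p. A pair thus records one integer per index,
  namely T p + T' p - p. Entries of both factors at the same index carry the same spectral
  parameter, because the shift a q^l in the second factor makes up for N = 0 against N = l; so an
  entry may cross the diagonal and change factors without a change in the formulas. The parameter c
  is attached to every i, and not only to those where some x_i acts, because it then varies simply:
  by a factor q or q^(-1) from i to i + 1, and under an exchange of j and j + 1 only at i = j + 1.
  The obstacle is the index \<alpha> where the diagonal part of T ends and that of T' begins. There
  both factors act nontrivially on entries that do not belong to A, and these actions have to
  disappear: for \<phi> by cancellation of two factors, for x by a zero in the coproduct.\<close>

unbundle fps_syntax

text \<open>
  The two expansions of \<open>1 / (1 - c z)\<close> have coefficients \<open>c\<^sup>r theta s r\<close>, so \<open>phi_coeff\<close> gives both
  expansions of \<open>q\<^bsup>-\<epsilon>\<^esup> + \<epsilon> (q - q\<inverse>) / (1 - c z)\<close>, which is \<open>\<psi>(c z)\<close> for \<open>\<epsilon> = 1\<close> and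
  \<open>\<psi>(c q\<^sup>2 z)\<inverse>\<close> for \<open>\<epsilon> = -1\<close>.
\<close>

primrec theta :: "sign \<Rightarrow> int \<Rightarrow> complex" where
  "theta Plus r = of_bool (0 \<le> r)"
| "theta Minus r = - of_bool (r < 0)"

definition phi_coeff :: "complex \<Rightarrow> sign \<Rightarrow> int \<Rightarrow> complex \<Rightarrow> int \<Rightarrow> complex" where
  "phi_coeff q s \<epsilon> c r =
     (if r = 0 then q powi (- \<epsilon>) else 0) +
     of_int \<epsilon> * (q - inverse q) * c powi r * theta s r"

text \<open>An entry i at index p has exponent i + N + 1 - 2 p and an entry i + 1 has i + N + 3 - 2
  p; the factor q^2 lets one parameter \<open>c\<close> serve both.\<close>

definition eps_phi :: "(complex \<Rightarrow> 'a::field) \<Rightarrow> 'a \<Rightarrow> complex \<Rightarrow> complex \<Rightarrow> int \<Rightarrow> 'a" where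
  "eps_phi \<iota> z q c \<epsilon> =
     (if \<epsilon> = - 1 then inverse (psi (\<iota> q) (\<iota> (c * q ^ 2) * z))
      else if \<epsilon> = 1 then psi (\<iota> q) (\<iota> c * z) else 1)"

text \<open>The pairing of h_i with the weight of the basis vector of A. It is the \<epsilon> to be
  used in \<open>phi_coeff\<close> and \<open>eps_phi\<close>.\<close>

definition wt_coeff :: "int \<Rightarrow> int set \<Rightarrow> int" where
  "wt_coeff i A = of_bool (i \<in> A) - of_bool (i + 1 \<in> A)"

lemma wt_coeff_cases: "wt_coeff i A = - 1 \<or> wt_coeff i A = 0 \<or> wt_coeff i A = 1"
  by (auto simp: wt_coeff_def)

text \<open>Inverting \<psi> amounts to inverting q, up to a shift of the argument. At w = 1 and u^2
  w = 1 a vanishing numerator or the convention for division by 0 makes both sides 0.\<close>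

lemma inverse_psi:
  fixes u w :: "'a::field"
  assumes "u \<noteq> 0"
  shows "inverse (psi u (u ^ 2 * w)) = psi (inverse u) w"
proof (cases "w = 1 \<or> u ^ 2 * w = 1")
  case True
  with assms show ?thesis by (auto simp: psi_def field_simps power2_eq_square)
next
  case False
  have "u - inverse u * (u ^ 2 * w) = u * (1 - w)"
    using assms by (simp add: field_simps power2_eq_square)
  moreover have "inverse u - u * w = inverse u * (1 - u ^ 2 * w)"
    using assms by (simp add: field_simps power2_eq_square)
  ultimately show ?thesis
    unfolding psi_def by (simp add: divide_inverse mult_ac)
qed

text \<open>Turns an expansion in the inverse variable into one in the variable itself, with q
  inverted. Together with \<open>inverse_psi\<close> it leaves a single series to compute.\<close>

lemma psi_inverse_arg:
  fixes u w :: "'a::field"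
  assumes "u \<noteq> 0" "w \<noteq> 0"
  shows "psi u (inverse w) = psi (inverse u) w"
proof (cases "w = 1")
  case False
  have "u - inverse u * inverse w = - inverse w * (inverse u - u * w)"
    "1 - inverse w = - inverse w * (1 - w)"
    using assms by (simp_all add: field_simps)
  then show ?thesis
    using assms by (simp add: psi_def)
qed (use assms in \<open>simp add: psi_def\<close>)

lemma psi_fls_X:
  fixes u d :: complex
  assumes "u \<noteq> 0"
  shows "psi (fls_const u) (fls_const d * fls_X) =
    fps_to_fls (Abs_fps (\<lambda>n. if n = 0 then u else (u - inverse u) * d ^ n))"
proof -
  let ?F = "Abs_fps (\<lambda>n. if n = 0 then u else (u - inverse u) * d ^ n)"
  have "?F * (1 - fps_const d * fps_X) = fps_const u - fps_const (inverse u * d) * fps_X"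
  proof (rule fps_ext)
    fix n
    show "(?F * (1 - fps_const d * fps_X)) $ n = (fps_const u - fps_const (inverse u * d) * fps_X) $ n"
    proof (cases n)
      case (Suc m)
      then show ?thesis
        using assms by (cases m) (simp_all add: algebra_simps)
    qed (simp add: algebra_simps)
  qed
  then have "fps_to_fls ?F * fps_to_fls (1 - fps_const d * fps_X) =
      fps_to_fls (fps_const u - fps_const (inverse u * d) * fps_X)"
    by (metis fls_times_fps_to_fls)
  then have *: "fps_to_fls ?F * (1 - fls_const d * fls_X) =
      fls_const u - inverse (fls_const u) * (fls_const d * fls_X)"
    by (simp add: fls_times_fps_to_fls fls_inverse_const mult.assoc flip: fls_const_mult_const)
  have "(1 - fps_const d * fps_X) $ 0 \<noteq> 0"
    by simp
  then have "fps_to_fls (1 - fps_const d * fps_X) \<noteq> 0"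
    by (metis fps_to_fls_eq_0_iff fps_zero_nth)
  then have "1 - fls_const d * fls_X \<noteq> 0"
    by (simp add: fls_times_fps_to_fls)
  with * show ?thesis
    by (simp add: psi_def field_simps)
qed

lemma eps_phi_fls:
  fixes q c :: complex
  assumes "q \<noteq> 0" "c \<noteq> 0" "\<epsilon> = - 1 \<or> \<epsilon> = 0 \<or> \<epsilon> = 1"
  shows "eps_phi fls_const (zvar s) q c \<epsilon> =
    fps_to_fls (Abs_fps (\<lambda>n. phi_coeff q s \<epsilon> c (sg s * int n)))"
proof -
  have X: "fls_const c * fls_X_inv = inverse (fls_const (inverse c) * fls_X)"
    using assms by (simp add: fls_inverse_X fls_inverse_const)
  have nz: "fls_const (inverse c) * fls_X \<noteq> 0" "fls_const q \<noteq> 0"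
    using assms by (simp_all add: fls_const_nonzero)
  have inv: "inverse (psi (fls_const q) (fls_const (c * q\<^sup>2) * z)) =
      psi (inverse (fls_const q)) (fls_const c * z)" for z
    using inverse_psi[OF nz(2), of "fls_const c * z"]
    by (simp add: power2_eq_square mult_ac flip: fls_const_mult_const)
  have inv_q: "inverse (fls_const q) = fls_const (inverse q)"
    by (simp add: fls_inverse_const)
  have zero: "fps_to_fls (Abs_fps (\<lambda>n. phi_coeff q s 0 c (sg s * int n))) = 1"
    by (cases s) (auto simp: phi_coeff_def fps_eq_iff)
  have coeffs: "Abs_fps (\<lambda>n. phi_coeff q Plus 1 c (int n)) =
        Abs_fps (\<lambda>n. if n = 0 then q else (q - inverse q) * c ^ n)"
      "Abs_fps (\<lambda>n. phi_coeff q Plus (- 1) c (int n)) =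
        Abs_fps (\<lambda>n. if n = 0 then inverse q else (inverse q - q) * c ^ n)"
      "Abs_fps (\<lambda>n. phi_coeff q Minus 1 c (- int n)) =
        Abs_fps (\<lambda>n. if n = 0 then inverse q else (inverse q - q) * inverse c ^ n)"
      "Abs_fps (\<lambda>n. phi_coeff q Minus (- 1) c (- int n)) =
        Abs_fps (\<lambda>n. if n = 0 then q else (q - inverse q) * inverse c ^ n)"
    by (simp_all add: fps_eq_iff phi_coeff_def power_int_minus power_inverse algebra_simps)
  have "psi (fls_const q) (fls_const c * fls_X_inv) =
      psi (fls_const (inverse q)) (fls_const (inverse c) * fls_X)"
    "psi (fls_const (inverse q)) (fls_const c * fls_X_inv) =
      psi (fls_const q) (fls_const (inverse c) * fls_X)"
    using psi_inverse_arg[OF nz(2,1)] psi_inverse_arg[of "fls_const (inverse q)", OF _ nz(1)] assms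
    by (simp_all add: X inv_q fls_inverse_const)
  moreover have "eps_phi fls_const z q c \<epsilon> =
      (if \<epsilon> = - 1 then psi (fls_const (inverse q)) (fls_const c * z)
       else if \<epsilon> = 1 then psi (fls_const q) (fls_const c * z) else 1)" for z
    by (simp add: eps_phi_def inv inv_q)
  moreover have "psi (fls_const (inverse q)) (fls_const d * fls_X) =
      fps_to_fls (Abs_fps (\<lambda>n. if n = 0 then inverse q else (inverse q - q) * d ^ n))" for d
    using psi_fls_X[of "inverse q" d] assms(1) by (simp cong: if_cong)
  ultimately show ?thesis
    using assms zero by (cases s) (auto simp: coeffs psi_fls_X simp del: One_nat_def)
qed

text \<open>\<open>h_eigenvalue\<close> is a logarithm and \<open>phi\<close> an exponential; this
  makes them cancel. \<open>fps_ln 1\<close> is log (1 + X), whence the subtraction of 1.\<close>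

lemma fps_exp_compose_ln:
  fixes f :: "complex fps"
  assumes "f $ 0 = 1"
  shows "fps_exp 1 oo (fps_ln 1 oo (f - 1)) = f"
proof -
  have "(fps_exp 1 - 1) oo fps_ln 1 = (fps_X :: complex fps)"
    using fps_inv_fps_exp_compose(2)[of "1::complex"] fps_ln_fps_exp_inv[of "1::complex"] by simp
  then have *: "fps_exp 1 oo fps_ln 1 = (1 + fps_X :: complex fps)"
    by (simp add: fps_compose_sub_distrib algebra_simps)
  have "fps_exp 1 oo (fps_ln 1 oo (f - 1)) = (1 + fps_X) oo (f - 1)"
    using assms by (simp add: fps_compose_assoc flip: *)
  then show ?thesis
    using assms by (simp add: fps_compose_add_distrib)
qed

section \<open>The model on finite sets of integers\<close>

lemma qpow_add: "qpow t (r + r') = qpow t r * qpow t r'"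
  by (simp add: qpow_def of_rat_add distrib_left exp_add)

lemma qpow_of_int: "qpow t (of_int k) = exp t powi k"
  using exp_power_int[of t k] by (simp add: qpow_def mult.commute)

definition swap :: "sign \<Rightarrow> int \<Rightarrow> int set \<Rightarrow> int set" where
  "swap s i A = insert (entry_to s i) (A - {entry_from s i})"

definition movable :: "sign \<Rightarrow> int \<Rightarrow> int set \<Rightarrow> bool" where
  "movable s i A \<longleftrightarrow> entry_from s i \<in> A \<and> entry_to s i \<notin> A"

text \<open>If the entry to be moved is the p-th smallest element of A, then p - 1 elements lie
  below i, whether the entry is i or i + 1. The exponent is then the i + N + 1 - 2 p of
  \<open>fund_x\<close> with N = l.\<close>

definition spec :: "complex \<Rightarrow> int \<Rightarrow> complex \<Rightarrow> int \<Rightarrow> int set \<Rightarrow> complex" where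
  "spec q l a i A = a * q powi (l + i - 1 - 2 * int (card {x \<in> A. x < i}))"

definition set_wt :: "int set \<Rightarrow> hspace \<Rightarrow> rat" where
  "set_wt A h = (\<Sum>i \<in> Poly_Mapping.keys h. Poly_Mapping.lookup h i * of_int (wt_coeff i A))"

lemma movable_simps:
  "movable Plus i A \<longleftrightarrow> i + 1 \<in> A \<and> i \<notin> A"
  "movable Minus i A \<longleftrightarrow> i \<in> A \<and> i + 1 \<notin> A"
  by (simp_all add: movable_def)

lemma in_swap: "x \<in> swap s i A \<longleftrightarrow> x = entry_to s i \<or> x \<in> A \<and> x \<noteq> entry_from s i"
  by (auto simp: swap_def)

lemma movable_wt_coeff: "movable s i A \<longleftrightarrow> wt_coeff i A = - sg s"
  by (cases s) (auto simp: movable_simps wt_coeff_def)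

text \<open>An exchange at j changes the weight by plus or minus the simple root of j, whose values
  on the h_i form a column of the Cartan matrix.\<close>

lemma wt_coeff_swap:
  assumes "movable s j A"
  shows "wt_coeff i (swap s j A) = wt_coeff i A + sg s * cartan i j"
proof -
  have "cartan i j = (if i = j then 2 else if i = j + 1 \<or> i + 1 = j then - 1 else 0)"
    by (auto simp: cartan_def)
  with assms show ?thesis
    by (cases s) (auto simp: wt_coeff_def movable_simps in_swap)
qed

lemma spec_nonzero [simp]: "q \<noteq> 0 \<Longrightarrow> a \<noteq> 0 \<Longrightarrow> spec q l a i A \<noteq> 0"
  by (simp add: spec_def)

text \<open>The number of elements below i changes only if i separates j from j + 1, that is for i =
  j + 1.\<close>

lemma spec_swap:
  assumes "finite A" "movable s j A" "q \<noteq> 0"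
  shows "spec q l a i (swap s j A) =
    (if i = j + 1 then q powi (- 2 * sg s) * spec q l a i A else spec q l a i A)"
proof -
  let ?B = "\<lambda>A. {x \<in> A. x < i}"
  have fin: "finite (?B A)"
    using assms by simp
  consider "i \<le> j" | "i \<ge> j + 2" | "i = j + 1" by linarith
  then have "int (card (?B (swap s j A))) = int (card (?B A)) + (if i = j + 1 then sg s else 0)"
  proof cases
    case 1
    then have "?B (swap s j A) = ?B A"
      using assms(2) by (cases s) (auto simp: in_swap movable_simps)
    with 1 show ?thesis by simp
  next
    case 2
    then have *: "?B (swap s j A) = insert (entry_to s j) (?B A - {entry_from s j})"
      by (cases s) (auto simp: in_swap)
    have "entry_from s j \<in> ?B A" "entry_to s j \<notin> ?B A"
      using 2 assms(2) by (cases s; simp add: movable_simps)+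
    then have "card (?B (swap s j A)) = card (?B A)"
      using fin card_Suc_Diff1[of "?B A" "entry_from s j"]
      unfolding * by (subst card_insert_disjoint) auto
    with 2 show ?thesis by simp
  next
    case 3
    show ?thesis
    proof (cases s)
      case Plus
      then have "?B (swap s j A) = insert j (?B A)" "j \<notin> ?B A"
        using 3 assms(2) by (auto simp: in_swap movable_simps)
      with 3 fin Plus show ?thesis by simp
    next
      case Minus
      then have "?B A = insert j (?B (swap s j A))" "j \<notin> ?B (swap s j A)"
        using 3 assms(2) by (auto simp: in_swap movable_simps)
      moreover have "finite (?B (swap s j A))"
        using assms(1) by (simp add: swap_def)
      ultimately have "card (?B A) = Suc (card (?B (swap s j A)))"
        by (metis card_insert_disjoint)
      with 3 Minus show ?thesis by simp
    qed
  qed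
  then have "l + i - 1 - 2 * int (card (?B (swap s j A))) =
      (l + i - 1 - 2 * int (card (?B A))) + (if i = j + 1 then - 2 * sg s else 0)"
    by simp
  then show ?thesis
    unfolding spec_def using assms(3) by (simp only:) (simp add: power_int_add)
qed

text \<open>The exponent grows by 1 with i, and drops by 2 if i itself is newly counted.\<close>

lemma spec_Suc:
  assumes "finite A" "q \<noteq> 0"
  shows "spec q l a (i + 1) A = (if i \<in> A then inverse q else q) * spec q l a i A"
proof -
  have "{x \<in> A. x < i + 1} = (if i \<in> A then insert i {x \<in> A. x < i} else {x \<in> A. x < i})"
    by (auto simp: zless_add1_eq less_le)
  then have "int (card {x \<in> A. x < i + 1}) = int (card {x \<in> A. x < i}) + (if i \<in> A then 1 else 0)"
    using assms by simp
  then have "l + (i + 1) - 1 - 2 * int (card {x \<in> A. x < i + 1}) =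
      (l + i - 1 - 2 * int (card {x \<in> A. x < i})) + (if i \<in> A then - 1 else 1)"
    by simp
  then show ?thesis
    unfolding spec_def using assms(2) by (simp only:) (simp add: power_int_add power_int_minus)
qed

lemma set_wt_add: "set_wt A (h + h') = set_wt A h + set_wt A h'"
  unfolding set_wt_def by (rule setsum_keys_plus_distrib) (simp_all add: distrib_right)

lemma set_wt_single: "set_wt A (Poly_Mapping.single i c) = c * of_int (wt_coeff i A)"
  by (simp add: set_wt_def)

lemma set_wt_superset:
  assumes "finite F" "Poly_Mapping.keys h \<subseteq> F"
  shows "set_wt A h = (\<Sum>i\<in>F. Poly_Mapping.lookup h i * of_int (wt_coeff i A))"
  unfolding set_wt_def using assms
  by (intro sum.mono_neutral_left) (auto simp: in_keys_iff)

lemma set_wt_swap: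
  assumes "movable s j A"
  shows "set_wt (swap s j A) h = set_wt A h + of_int (sg s) * alpha j h"
proof -
  let ?F = "Poly_Mapping.keys h \<union> {j - 1, j, j + 1}"
  have F: "finite ?F" "Poly_Mapping.keys h \<subseteq> ?F"
    by auto
  have "set_wt (swap s j A) h - set_wt A h =
      (\<Sum>i\<in>?F. Poly_Mapping.lookup h i * of_int (sg s * cartan i j))"
    unfolding set_wt_superset[OF F] wt_coeff_swap[OF assms] sum_subtractf[symmetric]
    by (simp add: algebra_simps)
  also have "\<dots> = (\<Sum>i\<in>{j - 1, j, j + 1}. Poly_Mapping.lookup h i * of_int (sg s * cartan i j))"
    by (rule sum.mono_neutral_right) (auto simp: cartan_def)
  also have "\<dots> = of_int (sg s) * alpha j h"
    by (simp add: cartan_def alpha_def Lam_def algebra_simps)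
  finally show ?thesis by simp
qed

text \<open>The basis is indexed by finite sets of integers, as in an exterior power. The operators
  are linear on the whole ambient space, as every \<open>lin_ext\<close> is, so composites are
  linear without side conditions and each relation needs a check on the e A only.\<close>

locale wedge_model = uq_rep scale t M
  for scale :: "complex \<Rightarrow> 'v::ab_group_add \<Rightarrow> 'v" and t :: complex and M :: "'v uq_data" +
  fixes l :: int and a :: complex and e :: "int set \<Rightarrow> 'v" and I :: "int set set"
  assumes q_not_root: "\<And>n::nat. n \<ge> 1 \<Longrightarrow> exp t ^ n \<noteq> 1"
    and a_nonzero: "a \<noteq> 0"
    and e_indep: "independent (e ` I)"
    and e_inj: "inj_on e I"
    and I_fin: "\<And>A. A \<in> I \<Longrightarrow> finite A"
    and I_swap: "\<And>s i A. A \<in> I \<Longrightarrow> movable s i A \<Longrightarrow> swap s i A \<in> I"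
    and V_eq: "Vsp M = span (e ` I)"
    and X_lin: "\<And>s i r. module_hom scale scale (Xop M s i r)"
    and K_lin: "\<And>h. module_hom scale scale (Kop M h)"
    and H_lin: "\<And>i m. module_hom scale scale (Hop M i m)"
    and X_e: "\<And>s i r A. A \<in> I \<Longrightarrow> Xop M s i r (e A) =
          (if movable s i A then scale (spec (exp t) l a i A powi r) (e (swap s i A)) else 0)"
    and K_e: "\<And>h A. A \<in> I \<Longrightarrow> Kop M h (e A) = scale (qpow t (set_wt A h)) (e A)"
    and H_e: "\<And>i m A. A \<in> I \<Longrightarrow> Hop M i m (e A) =
          scale (h_eigenvalue (exp t)
            (\<lambda>s. eps_phi fls_const (zvar s) (exp t) (spec (exp t) l a i A) (wt_coeff i A)) m) (e A)"
begin

abbreviation c :: "int \<Rightarrow> int set \<Rightarrow> complex" where "c i A \<equiv> spec q l a i A"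

lemma lin_ident: "module_hom scale scale (\<lambda>v. v)"
  by (simp add: module_hom_iff module_axioms)

lemma lin_comp:
  "module_hom scale scale f \<Longrightarrow> module_hom scale scale g \<Longrightarrow> module_hom scale scale (\<lambda>v. f (g v))"
  by (simp add: module_hom_iff)

lemma lin_zero: "module_hom scale scale (\<lambda>v. 0)"
  by (simp add: module_hom_iff module_axioms)

lemma lin_add: "module_hom scale scale f \<Longrightarrow> module_hom scale scale g \<Longrightarrow>
    module_hom scale scale (\<lambda>v. f v + g v)"
  by (simp add: module_hom_iff algebra_simps)

lemma lin_diff: "module_hom scale scale f \<Longrightarrow> module_hom scale scale g \<Longrightarrow>
    module_hom scale scale (\<lambda>v. f v - g v)"
  by (simp add: module_hom_iff algebra_simps)

lemma lin_scale: "module_hom scale scale f \<Longrightarrow> module_hom scale scale (\<lambda>v. scale b (f v))"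
  by (simp add: module_hom_iff algebra_simps)

lemma lin_sum: "(\<And>i. i \<in> J \<Longrightarrow> module_hom scale scale (f i)) \<Longrightarrow>
    module_hom scale scale (\<lambda>v. \<Sum>i\<in>J. f i v)"
  by (induction J rule: infinite_finite_induct) (simp_all add: lin_zero lin_add)

lemma lin_series_pow:
  assumes "\<And>m. module_hom scale scale (B m)"
  shows "module_hom scale scale (series_pow B k n)"
proof (induction k arbitrary: n)
  case 0
  show ?case by (cases "n = 0") (simp_all add: module_hom_iff module_axioms)
next
  case (Suc k)
  have "module_hom scale scale (\<lambda>v. \<Sum>m = 1..n. B m (series_pow B k (n - m) v))"
    by (intro lin_sum lin_comp[OF assms] Suc)
  then show ?case by simp
qed

lemma lin_phi: "module_hom scale scale (phi s i n)"
  unfolding phi_def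
  by (intro lin_comp[OF K_lin] lin_sum lin_scale lin_series_pow H_lin)

lemma lin_phiz: "module_hom scale scale (phiz s i r)"
  unfolding phiz_def by (cases "0 \<le> sg s * r") (simp_all add: lin_phi lin_zero)

lemmas lin_intros = lin_add lin_diff lin_scale lin_comp[OF X_lin] lin_comp[OF K_lin]
  lin_comp[OF lin_phi] lin_comp[OF lin_phiz] lin_ident lin_zero

lemma eq_on_V:
  assumes "module_hom scale scale f" "module_hom scale scale g"
    and "\<And>A. A \<in> I \<Longrightarrow> f (e A) = g (e A)" and "v \<in> Vsp M"
  shows "f v = g v"
  using assms(4) unfolding V_eq
proof (induction rule: span_induct_alt)
  case base
  show ?case using assms(1,2) by (simp add: module_hom.zero)
next
  case (step b x y)
  then show ?case
    using assms(3) by (auto simp: module_hom.add[OF assms(1)] module_hom.add[OF assms(2)]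
        module_hom.scale[OF assms(1)] module_hom.scale[OF assms(2)])
qed

lemma q_nonzero: "q \<noteq> 0"
  by simp

lemma q_powi_neq_1: "k \<noteq> 0 \<Longrightarrow> q powi k \<noteq> 1"
  using q_not_root[of "nat \<bar>k\<bar>"] by (cases "0 < k") (auto simp: power_int_def power_inverse Suc_le_eq)

lemma q_diff_nonzero: "q - inverse q \<noteq> 0"
proof
  assume "q - inverse q = 0"
  then have "q ^ 2 = 1"
    by (simp add: power2_eq_square field_simps)
  with q_not_root[of 2] show False by simp
qed

text \<open>On a common eigenvector the operators multiply like scalars. The hypothesis speaks of
  multiples of v because the recursion applies \<open>B m\<close> to such multiples.\<close>

lemma series_pow_e:
  assumes "\<And>m b. m \<ge> 1 \<Longrightarrow> B m (scale b v) = scale (b * g m) v"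
  shows "series_pow B k n v = scale ((Abs_fps (\<lambda>m. if m = 0 then 0 else g m) ^ k) $ n) v"
proof (induction k arbitrary: n)
  case (Suc k)
  let ?G = "Abs_fps (\<lambda>m. if m = 0 then 0 else g m)"
  have "series_pow B (Suc k) n v = (\<Sum>m = 1..n. scale (?G $ m * (?G ^ k) $ (n - m)) v)"
    using assms by (simp add: Suc mult.commute)
  also have "\<dots> = scale (\<Sum>m = 1..n. ?G $ m * (?G ^ k) $ (n - m)) v"
    by (simp add: scale_sum_left)
  also have "(\<Sum>m = 1..n. ?G $ m * (?G ^ k) $ (n - m)) = (\<Sum>m = 0..n. ?G $ m * (?G ^ k) $ (n - m))"
    by (rule sum.mono_neutral_left) auto
  also have "\<dots> = (?G ^ Suc k) $ n"
    by (simp add: fps_mult_nth)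
  finally show ?case .
qed simp

text \<open>The \<open>Hop\<close> operators reproduce the prescribed series divided by its constant
  term, since exponential and logarithm cancel; \<open>Kop\<close> at plus or minus h_i restores the
  constant term.\<close>

lemma phi_e:
  assumes "A \<in> I"
  shows "phi s i n (e A) = scale (phi_coeff q s (wt_coeff i A) (c i A) (sg s * int n)) (e A)"
proof -
  define f where "f = Abs_fps (\<lambda>n. phi_coeff q s (wt_coeff i A) (c i A) (sg s * int n))"
  define F where "F s = eps_phi fls_const (zvar s) q (c i A) (wt_coeff i A)" for s
  have F: "fls_regpart (F s) = f"
    using wt_coeff_cases[of i A] a_nonzero unfolding F_def f_def
    by (subst eps_phi_fls) auto
  then have F0: "fls_nth (F s) 0 = f $ 0"
    by (metis fls_regpart_nth of_nat_0)
  define f1 where "f1 = fps_const (inverse (f $ 0)) * f"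
  have f0: "f $ 0 = q powi (sg s * wt_coeff i A)"
    using wt_coeff_cases[of i A]
    by (cases s) (auto simp: f_def phi_coeff_def power_int_minus)
  then have f0_nz: "f $ 0 \<noteq> 0" by simp
  define g where "g m = of_int (sg s) * (q - inverse q) * h_eigenvalue q F (sg s * int m)" for m
  have sg2: "of_int (sg s) * of_int (sg s) = (1::complex)"
    by (cases s) auto
  have sgm: "(if 0 < sg s * int m then Plus else Minus) = s" "nat \<bar>sg s * int m\<bar> = m" if "m \<ge> 1" for m
    using that by (cases s; simp)+
  have g: "g m = (fps_ln 1 oo (f1 - 1)) $ m" if "m \<ge> 1" for m
  proof -
    have "g m = of_int (sg s) * of_int (sg s) * (fps_ln 1 oo (f1 - 1)) $ m"
      unfolding g_def h_eigenvalue_def using sgm[OF that] q_diff_nonzero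
      by (simp add: F F0 f1_def)
    with sg2 show ?thesis by simp
  qed
  have G: "Abs_fps (\<lambda>m. if m = 0 then 0 else g m) = fps_ln 1 oo (f1 - 1)"
    using g by (intro fps_ext) simp
  have H: "scale (of_int (sg s) * (q - inverse q)) (Hop M i (sg s * int m) (scale b (e A))) =
      scale (b * g m) (e A)" for m b
    using assms by (simp add: module_hom.scale[OF H_lin] H_e g_def F_def[abs_def] mult_ac)
  have "(\<Sum>k\<le>n. scale (1 / fact k) (series_pow
        (\<lambda>m u. scale (of_int (sg s) * (q - inverse q)) (Hop M i (sg s * int m) u)) k n (e A))) =
      (\<Sum>k\<le>n. scale (1 / fact k * ((fps_ln 1 oo (f1 - 1)) ^ k) $ n) (e A))"
    using series_pow_e[of _ "e A" g, OF H] by (simp add: G)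
  also have "\<dots> = scale (\<Sum>k\<le>n. 1 / fact k * ((fps_ln 1 oo (f1 - 1)) ^ k) $ n) (e A)"
    by (simp add: scale_sum_left)
  also have "(\<Sum>k\<le>n. 1 / fact k * ((fps_ln 1 oo (f1 - 1)) ^ k) $ n) =
      (fps_exp 1 oo (fps_ln 1 oo (f1 - 1))) $ n"
    by (simp add: fps_compose_nth atLeast0AtMost)
  also have "\<dots> = f1 $ n"
    by (subst fps_exp_compose_ln) (use f0_nz in \<open>simp_all add: f1_def\<close>)
  finally have "phi s i n (e A) = scale (f1 $ n * q powi (sg s * wt_coeff i A)) (e A)"
    unfolding phi_def using assms
    by (simp add: module_hom.scale[OF K_lin] K_e set_wt_single
        flip: of_int_mult qpow_of_int)
  also have "f1 $ n * q powi (sg s * wt_coeff i A) = f $ n"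
    using f0 f0_nz by (simp add: f1_def)
  finally show ?thesis by (simp add: f_def)
qed

text \<open>\<open>phi_coeff\<close> is 0 at exponents of the wrong sign, so the truncation in
  \<open>phiz\<close> is automatic.\<close>

lemma phiz_e:
  assumes "A \<in> I"
  shows "phiz s i r (e A) = scale (phi_coeff q s (wt_coeff i A) (c i A) r) (e A)"
  using assms by (cases s) (auto simp: phiz_def phi_e phi_coeff_def)

end

section \<open>Scalar identities and combinatorics of exchanges\<close>

lemma theta_pred: "theta s r = theta s (r - 1) + of_bool (r = 0)"
  by (cases s) auto

lemma phi_coeff_zero: "phi_coeff q s 0 c r = of_bool (r = 0)"
  by (simp add: phi_coeff_def)

text \<open>
  The coefficient form of
  \<open>(1 - c z) \<phi>(z) = q\<^bsup>\<epsilon>\<^esup> - q\<^bsup>-\<epsilon>\<^esup> c z\<close>, which holds for both expansions of \<open>\<phi>\<close>.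
\<close>

lemma phi_coeff_rec:
  assumes "q \<noteq> 0" "c \<noteq> 0" "\<epsilon> = - 1 \<or> \<epsilon> = 0 \<or> \<epsilon> = 1"
  shows "phi_coeff q s \<epsilon> c r - c * phi_coeff q s \<epsilon> c (r - 1) =
    (if r = 0 then q powi \<epsilon> else 0) - (if r = 1 then c * q powi (- \<epsilon>) else 0)"
proof -
  have C: "c powi r = c * c powi (r - 1)"
    using assms(2) power_int_add[of c 1 "r - 1"] by simp
  have "phi_coeff q s \<epsilon> c r - c * phi_coeff q s \<epsilon> c (r - 1) =
      (if r = 0 then q powi (- \<epsilon>) + of_int \<epsilon> * (q - inverse q) else 0)
      - (if r = 1 then c * q powi (- \<epsilon>) else 0)"
    unfolding phi_coeff_def theta_pred[of s r] C
    using assms(1,2) by (auto simp: field_simps power_int_minus)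
  also have "q powi (- \<epsilon>) + of_int \<epsilon> * (q - inverse q) = q powi \<epsilon>"
    using assms(3) by (auto simp: power_int_minus)
  finally show ?thesis .
qed

text \<open>Multiplied by q, the series for \<epsilon> = 1 and \<epsilon> = -1 are (q^2 - c z) / (1
  - c z) and (1 - q^2 c z) / (1 - c z). Cross-multiplying the numerators gives the claim for both
  signs.\<close>

lemma phi_coeff_reflect:
  assumes "q \<noteq> 0" "c \<noteq> 0"
  shows "phi_coeff q e (sg s) c r - q powi (2 * sg s) * c * phi_coeff q e (sg s) c (r - 1) =
    q powi (2 * sg s) * phi_coeff q e (- sg s) c r - c * phi_coeff q e (- sg s) c (r - 1)"
proof -
  have C: "c powi r = c * c powi (r - 1)"
    using assms(2) power_int_add[of c 1 "r - 1"] by simp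
  show ?thesis
    unfolding phi_coeff_def theta_pred[of e r] C
    using assms by (cases s)
      (auto simp: field_simps power_int_minus power_int_add power2_eq_square power3_eq_cube)
qed

lemma swap_far:
  assumes "\<bar>i - j\<bar> \<ge> 2"
  shows "movable s i (swap s' j A) \<longleftrightarrow> movable s i A"
    and "swap s i (swap s' j A) = swap s' j (swap s i A)"
  using assms by (cases s; cases s'; auto simp: movable_simps in_swap)+

lemma movable_swap_same: "\<not> movable s i (swap s i A)"
  by (cases s) (auto simp: movable_simps in_swap)

lemma movable_swap_opposite:
  "movable Minus i A \<Longrightarrow> movable Plus i (swap Minus i A) \<and> swap Plus i (swap Minus i A) = A"
  "movable Plus i A \<Longrightarrow> movable Minus i (swap Plus i A) \<and> swap Minus i (swap Plus i A) = A"
  by (auto simp: movable_simps in_swap)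

text \<open>The exchange at j either removes the entry that would move at i or fills its target.
  Hence x_i^+ and x_j^- commute for neighbours because both products are 0.\<close>

lemma movable_swap_near_opposite:
  assumes "\<bar>i - j\<bar> = 1" "s \<noteq> s'"
  shows "\<not> movable s i (swap s' j A)"
proof -
  from assms(1) have "i = j + 1 \<or> j = i + 1" by linarith
  with assms(2) show ?thesis
    by (cases s; cases s') (auto simp: movable_simps in_swap)
qed

text \<open>After the exchange at j a second move at i finds its source empty or its target
  occupied. This disposes of the middle terms of the Serre relations.\<close>

lemma movable_swap_near_twice:
  assumes "\<bar>i - j\<bar> = 1"
  shows "\<not> movable s i (swap s j (swap s i A))"
proof -
  from assms(1) have "i = j + 1 \<or> j = i + 1" by linarith
  then show ?thesis
    by (cases s) (auto simp: movable_simps in_swap)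
qed

section \<open>The defining relations on basis vectors\<close>

context wedge_model
begin

lemma c_nonzero [simp]: "c i A \<noteq> 0"
  using a_nonzero by simp

lemmas c_swap = spec_swap[OF I_fin _ q_nonzero, of _ _ _ l a]

text \<open>Either the same entry moves a second time, or an entry at an adjacent index p follows
  it. In both cases the exponent, which is i - 2 p up to a constant, changes by
  -\<open>sg s\<close>.\<close>

lemma c_swap_near:
  assumes "A \<in> I" "\<bar>i - j\<bar> = 1" "movable s j A" "movable s i (swap s j A)"
  shows "c i (swap s j A) = q powi (- sg s) * c j A"
proof -
  note S = spec_Suc[OF I_fin[OF assms(1)] q_nonzero, of l a]
  from assms(2) have "i = j + 1 \<or> j = i + 1" by linarith
  then show ?thesis
  proof
    assume "i = j + 1"
    then show ?thesis
      using assms S[of j]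
      by (cases s) (auto simp: c_swap movable_simps in_swap power_int_minus power2_eq_square)
  next
    assume "j = i + 1"
    then show ?thesis
      using assms S[of i]
      by (cases s) (auto simp: c_swap movable_simps in_swap power_int_minus)
  qed
qed

lemma X_zero [simp]: "Xop M s i r 0 = 0"
  by (rule module_hom.zero[OF X_lin])

lemma X_scale [simp]: "Xop M s i r (scale b v) = scale b (Xop M s i r v)"
  by (rule module_hom.scale[OF X_lin])

lemmas op_scale [simp] = module_hom.scale[OF K_lin] module_hom.scale[OF lin_phi]
  module_hom.scale[OF lin_phiz] module_hom.zero[OF K_lin] module_hom.zero[OF lin_phi]
  module_hom.zero[OF lin_phiz]

lemma X_far:
  assumes "A \<in> I" "\<bar>i - j\<bar> \<ge> 2"
  shows "Xop M s i r (Xop M s' j p (e A)) = Xop M s' j p (Xop M s i r (e A))"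
proof -
  have "\<bar>j - i\<bar> \<ge> 2" "i \<noteq> j + 1" "j \<noteq> i + 1"
    using assms(2) by auto
  with assms show ?thesis
    by (auto simp: X_e I_swap swap_far c_swap mult.commute)
qed

lemma X_same: "A \<in> I \<Longrightarrow> Xop M s i r (Xop M s i p (e A)) = 0"
  by (simp add: X_e I_swap movable_swap_same)

lemma X_near_opposite:
  "A \<in> I \<Longrightarrow> \<bar>i - j\<bar> = 1 \<Longrightarrow> s \<noteq> s' \<Longrightarrow> Xop M s i r (Xop M s' j p (e A)) = 0"
  by (simp add: X_e I_swap movable_swap_near_opposite)

text \<open>The product is a multiple of two delta functions whose parameters have ratio
  q^(-\<open>sg s\<close>), so the linear factor of the quadratic relation annihilates it.\<close>

lemma X_near:
  assumes "A \<in> I" "\<bar>i - j\<bar> = 1"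
  shows "Xop M s i r (Xop M s j p (e A)) =
    scale (q powi (- sg s)) (Xop M s i (r - 1) (Xop M s j (p + 1) (e A)))"
proof (cases "movable s j A \<and> movable s i (swap s j A)")
  case True
  have "c i (swap s j A) powi r = c i (swap s j A) powi (r - 1) * (q powi (- sg s) * c j A)"
    unfolding c_swap_near[OF assms True[THEN conjunct1] True[THEN conjunct2], symmetric]
    using power_int_add[of "c i (swap s j A)" "r - 1" 1] by simp
  then show ?thesis
    using assms True by (simp add: X_e I_swap power_int_add mult_ac)
next
  case False
  with assms show ?thesis by (auto simp: X_e I_swap)
qed

lemma X_near_twice:
  assumes "A \<in> I" "\<bar>i - j\<bar> = 1"
  shows "Xop M s i r (Xop M s j n (Xop M s i p (e A))) = 0"
  using assms by (simp add: X_e I_swap movable_swap_near_twice)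

lemma closed:
  assumes "module_hom scale scale f" "\<And>A. A \<in> I \<Longrightarrow> f (e A) \<in> Vsp M" "v \<in> Vsp M"
  shows "f v \<in> Vsp M"
  using assms(3,2) unfolding V_eq
proof (induction rule: span_induct_alt)
  case base
  show ?case using assms(1) by (simp add: module_hom.zero span_zero)
next
  case (step b x y)
  then show ?case
    by (auto simp: module_hom.add[OF assms(1)] module_hom.scale[OF assms(1)]
        intro!: span_add span_scale)
qed

lemma e_in_V: "A \<in> I \<Longrightarrow> e A \<in> Vsp M"
  by (simp add: V_eq span_base)

lemma scale_in_V: "v \<in> Vsp M \<Longrightarrow> scale b v \<in> Vsp M"
  by (simp add: V_eq span_scale)

lemma zero_in_V: "0 \<in> Vsp M"
  by (simp add: V_eq span_zero)

text \<open>The relation between \<phi>_i and x_j on e A, divided by a power of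
  \<open>c j A\<close>. At i = j the exchange reverses \<epsilon>; for neighbours \<phi>_i is
  trivial either before or after it; for distant i nothing changes.\<close>

lemma phi_coeff_swap:
  assumes "A \<in> I" "movable s j A"
  shows "phi_coeff q e' (wt_coeff i (swap s j A)) (c i (swap s j A)) m
      - q powi (sg s * cartan i j) * c j A
        * phi_coeff q e' (wt_coeff i (swap s j A)) (c i (swap s j A)) (m - 1) =
    q powi (sg s * cartan i j) * phi_coeff q e' (wt_coeff i A) (c i A) m
      - c j A * phi_coeff q e' (wt_coeff i A) (c i A) (m - 1)"
proof -
  note S = spec_Suc[OF I_fin[OF assms(1)] q_nonzero, of l a]
  consider "i = j" | "\<bar>i - j\<bar> = 1" | "\<bar>i - j\<bar> \<ge> 2" by linarith
  then show ?thesis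
  proof cases
    case 1
    then have "cartan i j = 2" "wt_coeff i A = - sg s" "wt_coeff i (swap s j A) = sg s"
      "c i (swap s j A) = c j A"
      using assms by (auto simp: cartan_def movable_wt_coeff wt_coeff_swap c_swap)
    then show ?thesis
      using 1 phi_coeff_reflect[of q "c j A" e' s m] by (simp add: mult.commute)
  next
    case 2
    let ?\<phi> = "phi_coeff q e' (wt_coeff i A) (c i A)"
      and ?\<phi>' = "phi_coeff q e' (wt_coeff i (swap s j A)) (c i (swap s j A))"
    have cartan: "cartan i j = - 1"
      using 2 by (auto simp: cartan_def)
    have pow: "inverse (q powi sg s) * (q powi sg s * b) = b" for b
      by simp
    from 2 have ij: "i = j + 1 \<or> j = i + 1" by linarith
    \<comment> \<open>The weight is 0 on exactly one side of the exchange. On the other side the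
      parameter is the one for which the linear factor of the relation cancels the denominator of
      \<phi>_i, as in \<open>phi_coeff_rec\<close>.\<close>
    have "wt_coeff i A = sg s \<and> c i A = q powi sg s * c j A \<or>
        wt_coeff i A = 0 \<and> c i (swap s j A) = q powi (- sg s) * c j A"
      using ij
    proof
      assume "i = j + 1"
      then show ?thesis
        using assms S[of j]
        by (cases s) (auto simp: c_swap movable_simps wt_coeff_def power_int_minus power2_eq_square)
    next
      assume "j = i + 1"
      then show ?thesis
        using assms S[of i]
        by (cases s) (auto simp: c_swap movable_simps wt_coeff_def power_int_minus)
    qed
    then show ?thesis
    proof
      assume *: "wt_coeff i A = sg s \<and> c i A = q powi sg s * c j A"
      then have "wt_coeff i (swap s j A) = 0"
        by (simp add: wt_coeff_swap[OF assms(2)] cartan)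
      moreover have "?\<phi> m - c i A * ?\<phi> (m - 1) =
          (if m = 0 then q powi sg s else 0) - (if m = 1 then c i A * q powi (- sg s) else 0)"
        using phi_coeff_rec[of q "c i A" "wt_coeff i A" e' m] wt_coeff_cases[of i A] *
        by auto
      then have "q powi (- sg s) * (?\<phi> m - q powi sg s * c j A * ?\<phi> (m - 1)) =
          q powi (- sg s) * ((if m = 0 then q powi sg s else 0)
            - (if m = 1 then c j A else 0))"
        using * by (simp add: power_int_minus)
      ultimately show ?thesis
        by (auto simp: cartan phi_coeff_zero right_diff_distrib power_int_minus mult.assoc pow)
    next
      assume *: "wt_coeff i A = 0 \<and> c i (swap s j A) = q powi (- sg s) * c j A"
      then have w: "wt_coeff i (swap s j A) = - sg s"
        by (simp add: wt_coeff_swap[OF assms(2)] cartan)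
      have "?\<phi>' m - c i (swap s j A) * ?\<phi>' (m - 1) =
          (if m = 0 then q powi (- sg s) else 0)
            - (if m = 1 then c i (swap s j A) * q powi sg s else 0)"
        using phi_coeff_rec[of q "c i (swap s j A)" "wt_coeff i (swap s j A)" e' m]
          wt_coeff_cases[of i "swap s j A"] w
        by auto
      with * show ?thesis
        by (auto simp: cartan phi_coeff_zero power_int_minus)
    qed
  next
    case 3
    then have "cartan i j = 0" "i \<noteq> j + 1"
      by (auto simp: cartan_def)
    with assms show ?thesis
      by (simp add: wt_coeff_swap c_swap)
  qed
qed

lemma phi_coeff_diff:
  "phi_coeff q Plus \<epsilon> b r - phi_coeff q Minus \<epsilon> b r = of_int \<epsilon> * (q - inverse q) * b powi r"
  by (simp add: phi_coeff_def algebra_simps)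

text \<open>The two expansions of \<phi>_i differ by \<epsilon> (q - q^(-1)) times a delta function.
  For i = j at most one product on the left survives, and the value of \<epsilon> tells
  which.\<close>

lemma XP_XM_e:
  assumes "A \<in> I"
  shows "Xop M Plus i r (Xop M Minus j p (e A)) - Xop M Minus j p (Xop M Plus i r (e A)) =
    (if i = j then scale (1 / (q - inverse q)) (phiz Plus i (r + p) (e A) - phiz Minus i (r + p) (e A))
     else 0)"
proof (cases "i = j")
  case True
  have "q \<noteq> inverse q"
    using q_diff_nonzero by simp
  then have "scale (1 / (q - inverse q)) (phiz Plus i (r + p) (e A) - phiz Minus i (r + p) (e A)) =
      scale (of_int (wt_coeff i A) * c i A powi (r + p)) (e A)"
    using assms by (simp add: phiz_e phi_coeff_diff flip: scale_left_diff_distrib)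
  also have "\<dots> = Xop M Plus i r (Xop M Minus i p (e A)) - Xop M Minus i p (Xop M Plus i r (e A))"
    using assms movable_swap_opposite[of i A]
    by (auto simp: X_e I_swap c_swap power_int_add mult.commute)
      (auto simp: movable_wt_coeff wt_coeff_def)
  finally show ?thesis
    using True by simp
next
  case False
  then consider "\<bar>i - j\<bar> = 1" | "\<bar>i - j\<bar> \<ge> 2" by linarith
  then show ?thesis
  proof cases
    case 1
    then have "\<bar>j - i\<bar> = 1" by linarith
    with 1 False assms show ?thesis
      by (simp add: X_near_opposite)
  next
    case 2
    with False assms show ?thesis
      by (simp add: X_far)
  qed
qed

text \<open>For i = j and for neighbours each side vanishes by itself, by \<open>X_same\<close> and
  \<open>X_near\<close>; otherwise the operators commute and the scalar is 1.\<close>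

lemma X_X_e:
  assumes "A \<in> I"
  shows "Xop M s i r (Xop M s j (p - 1) (e A))
      - scale (q powi (sg s * cartan i j)) (Xop M s i (r - 1) (Xop M s j p (e A))) =
    scale (q powi (sg s * cartan i j)) (Xop M s j (p - 1) (Xop M s i r (e A)))
      - Xop M s j p (Xop M s i (r - 1) (e A))"
proof -
  consider "i = j" | "\<bar>i - j\<bar> = 1" | "\<bar>i - j\<bar> \<ge> 2" by linarith
  then show ?thesis
  proof cases
    case 1
    with assms show ?thesis by (simp add: X_same)
  next
    case 2
    then have "cartan i j = - 1" "\<bar>j - i\<bar> = 1"
      by (auto simp: cartan_def)
    with 2 assms show ?thesis
      using X_near[OF assms 2, of s r "p - 1"] X_near[OF assms \<open>\<bar>j - i\<bar> = 1\<close>, of s p "r - 1"]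
      by simp
  next
    case 3
    then have "cartan i j = 0"
      by (auto simp: cartan_def)
    with 3 assms show ?thesis
      by (simp add: X_far)
  qed
qed

theorem uq_module: "uq_module scale t M"
proof unfold_locales
  show "subspace (Vsp M)"
    by (simp add: V_eq)
next
  fix s i r v assume v: "v \<in> Vsp M"
  show "Xop M s i r v \<in> Vsp M"
    by (rule closed[OF X_lin _ v]) (simp add: X_e e_in_V I_swap scale_in_V zero_in_V)
next
  fix h v assume v: "v \<in> Vsp M"
  show "Kop M h v \<in> Vsp M"
    by (rule closed[OF K_lin _ v]) (simp add: K_e e_in_V scale_in_V)
next
  fix i m v assume v: "v \<in> Vsp M"
  show "Hop M i m v \<in> Vsp M"
    by (rule closed[OF H_lin _ v]) (simp add: H_e e_in_V scale_in_V)
next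
  fix s i r b u v
  show "Xop M s i r (scale b u + v) = scale b (Xop M s i r u) + Xop M s i r v"
    by (simp add: module_hom.add[OF X_lin])
next
  fix h b u v
  show "Kop M h (scale b u + v) = scale b (Kop M h u) + Kop M h v"
    by (simp add: module_hom.add[OF K_lin])
next
  fix i m b u v
  show "Hop M i m (scale b u + v) = scale b (Hop M i m u) + Hop M i m v"
    by (simp add: module_hom.add[OF H_lin] module_hom.scale[OF H_lin])
next
  fix h h' v assume "v \<in> Vsp M"
  then show "Kop M h (Kop M h' v) = Kop M (h + h') v"
    by (rule eq_on_V[rotated -1]; (intro lin_intros K_lin)?)
      (simp add: K_e set_wt_add qpow_add mult.commute)
next
  fix v assume "v \<in> Vsp M"
  then show "Kop M 0 v = v"
    by (rule eq_on_V[rotated -1]; (intro lin_intros K_lin)?)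
      (simp add: K_e set_wt_def qpow_def)
next
  fix h s i n v assume "v \<in> Vsp M"
  then show "Kop M h (phi s i n v) = phi s i n (Kop M h v)"
    by (rule eq_on_V[rotated -1]; (intro lin_comp[OF K_lin lin_phi] lin_comp[OF lin_phi K_lin])?)
      (simp add: K_e phi_e mult.commute)
next
  fix s i n s' j p v assume "v \<in> Vsp M"
  then show "phi s i n (phi s' j p v) = phi s' j p (phi s i n v)"
    by (rule eq_on_V[rotated -1]; (intro lin_comp[OF lin_phi lin_phi])?)
      (simp add: phi_e mult.commute)
next
  fix h s j r v assume "v \<in> Vsp M"
  then show "Kop M h (Xop M s j r (Kop M (- h) v)) =
      scale (qpow t (of_int (sg s) * alpha j h)) (Xop M s j r v)"
  proof (rule eq_on_V[rotated -1])
    fix A assume A: "A \<in> I"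
    have "qpow t (set_wt A (- h)) * qpow t (set_wt A h) = 1"
      unfolding qpow_add[symmetric] set_wt_add[symmetric] by (simp add: set_wt_def qpow_def)
    then show "Kop M h (Xop M s j r (Kop M (- h) (e A))) =
        scale (qpow t (of_int (sg s) * alpha j h)) (Xop M s j r (e A))"
      using A by (simp add: K_e X_e I_swap set_wt_swap qpow_add mult_ac)
  qed (intro lin_scale lin_comp[OF K_lin] lin_comp[OF X_lin] K_lin X_lin)+
next
  fix e' s i j m r v assume "v \<in> Vsp M"
  then show "phiz e' i m (Xop M s j (r - 1) v)
      - scale (q powi (sg s * cartan i j)) (phiz e' i (m - 1) (Xop M s j r v)) =
    scale (q powi (sg s * cartan i j)) (Xop M s j (r - 1) (phiz e' i m v))
      - Xop M s j r (phiz e' i (m - 1) v)"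
  proof (rule eq_on_V[rotated -1])
    fix A assume A: "A \<in> I"
    show "phiz e' i m (Xop M s j (r - 1) (e A))
        - scale (q powi (sg s * cartan i j)) (phiz e' i (m - 1) (Xop M s j r (e A))) =
      scale (q powi (sg s * cartan i j)) (Xop M s j (r - 1) (phiz e' i m (e A)))
        - Xop M s j r (phiz e' i (m - 1) (e A))"
    proof (cases "movable s j A")
      case True
      have C: "c j A powi r = c j A powi (r - 1) * c j A"
        using power_int_add[of "c j A" "r - 1" 1] by simp
      show ?thesis
        using A True arg_cong[OF phi_coeff_swap[OF A True, of e' i m], of "\<lambda>x. c j A powi (r - 1) * x"]
        by (simp add: X_e phiz_e I_swap C algebra_simps flip: scale_left_diff_distrib)
    qed (use A in \<open>simp add: X_e phiz_e\<close>)
  qed (intro lin_diff lin_scale lin_comp[OF lin_phiz] lin_comp[OF X_lin] lin_phiz X_lin)+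
next
  fix i j r p v assume "v \<in> Vsp M"
  then show "Xop M Plus i r (Xop M Minus j p v) - Xop M Minus j p (Xop M Plus i r v) =
      (if i = j
       then scale (1 / (q - inverse q)) (phiz Plus i (r + p) v - phiz Minus i (r + p) v)
       else 0)"
  proof (rule eq_on_V[rotated -1])
    show "module_hom scale scale (\<lambda>v. if i = j
       then scale (1 / (q - inverse q)) (phiz Plus i (r + p) v - phiz Minus i (r + p) v) else 0)"
      by (cases "i = j") (simp_all add: lin_diff lin_scale lin_phiz lin_zero)
  qed (intro XP_XM_e lin_diff lin_comp[OF X_lin] X_lin; assumption)+
next
  fix s i j r p v assume "v \<in> Vsp M"
  then show "Xop M s i r (Xop M s j (p - 1) v)
      - scale (q powi (sg s * cartan i j)) (Xop M s i (r - 1) (Xop M s j p v)) =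
    scale (q powi (sg s * cartan i j)) (Xop M s j (p - 1) (Xop M s i r v))
      - Xop M s j p (Xop M s i (r - 1) v)"
    by (rule eq_on_V[rotated -1])
      (intro X_X_e lin_diff lin_scale lin_comp[OF X_lin] X_lin; assumption)+
next
  fix s r p n v and i j :: int assume ij: "\<bar>i - j\<bar> = 1" and "v \<in> Vsp M"
  from this(2) show "(Xop M s i r (Xop M s i p (Xop M s j n v))
      - scale (q + inverse q) (Xop M s i r (Xop M s j n (Xop M s i p v)))
      + Xop M s j n (Xop M s i r (Xop M s i p v)))
    + (Xop M s i p (Xop M s i r (Xop M s j n v))
      - scale (q + inverse q) (Xop M s i p (Xop M s j n (Xop M s i r v)))
      + Xop M s j n (Xop M s i p (Xop M s i r v))) = 0"
  proof (rule eq_on_V[rotated -1])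
    fix A assume "A \<in> I"
    \<comment> \<open>Each of the six Serre terms is 0 by itself. Here x_i x_i meets a vector whose
      set has already been exchanged at j.\<close>
    moreover have "Xop M s i r (Xop M s i p (Xop M s j n (e A))) = 0" if "A \<in> I" for r p n A
      using that by (simp add: X_e[of A] X_same I_swap)
    ultimately show "(Xop M s i r (Xop M s i p (Xop M s j n (e A)))
        - scale (q + inverse q) (Xop M s i r (Xop M s j n (Xop M s i p (e A))))
        + Xop M s j n (Xop M s i r (Xop M s i p (e A))))
      + (Xop M s i p (Xop M s i r (Xop M s j n (e A)))
        - scale (q + inverse q) (Xop M s i p (Xop M s j n (Xop M s i r (e A))))
        + Xop M s j n (Xop M s i p (Xop M s i r (e A)))) = 0"
      using ij by (simp add: X_same X_near_twice)
  qed (intro lin_zero lin_add lin_diff lin_scale lin_comp[OF X_lin] X_lin)+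
next
  fix s r p v and i j :: int assume ij: "\<bar>i - j\<bar> \<ge> 2" and "v \<in> Vsp M"
  from this(2) show "Xop M s i r (Xop M s j p v) = Xop M s j p (Xop M s i r v)"
    by (rule eq_on_V[rotated -1])
      (intro X_far ij lin_comp[OF X_lin] X_lin; assumption)+
qed

end

section \<open>Joint spectrum of the Cartan subalgebra\<close>

text \<open>At the largest element i of the symmetric difference the sets agree on i + 1, so the
  weights differ at i. Finiteness supplies that largest element.\<close>

lemma wt_coeff_determines_set:
  assumes "finite A" "finite B" "\<And>i. wt_coeff i A = wt_coeff i B"
  shows "A = B"
proof (rule ccontr)
  assume "A \<noteq> B"
  let ?D = "(A - B) \<union> (B - A)"
  have D: "finite ?D" "?D \<noteq> {}"
    using assms \<open>A \<noteq> B\<close> by auto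
  define i where "i = Max ?D"
  have "i \<in> ?D" "i + 1 \<notin> ?D"
    using Max_in[OF D] Max_ge[OF D(1), of "i + 1"] by (auto simp: i_def)
  then have "wt_coeff i A \<noteq> wt_coeff i B"
    by (auto simp: wt_coeff_def)
  with assms(3) show False by simp
qed

context wedge_model
begin

definition coord :: "'v \<Rightarrow> int set \<Rightarrow> complex" where
  "coord v A = representation (e ` I) v (e A)"

lemma coord_e: "A \<in> I \<Longrightarrow> B \<in> I \<Longrightarrow> coord (e B) A = of_bool (A = B)"
  using e_inj by (auto simp: coord_def representation_basis[OF e_indep] inj_on_eq_iff)

lemma coord_add: "u \<in> Vsp M \<Longrightarrow> v \<in> Vsp M \<Longrightarrow> coord (u + v) A = coord u A + coord v A"
  by (simp add: coord_def V_eq representation_add[OF e_indep])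

lemma coord_scale: "v \<in> Vsp M \<Longrightarrow> coord (scale b v) A = b * coord v A"
  by (simp add: coord_def V_eq representation_scale[OF e_indep])

lemma coord_zero: "coord 0 A = 0"
  by (simp add: coord_def representation_zero)

lemma in_span_single:
  assumes "v \<in> Vsp M" "\<And>A. A \<in> I \<Longrightarrow> A \<noteq> B \<Longrightarrow> coord v A = 0" "B \<in> I"
  shows "v \<in> span {e B}"
proof -
  have "v = (\<Sum>x | representation (e ` I) v x \<noteq> 0. scale (representation (e ` I) v x) x)"
    using sum_nonzero_representation_eq[OF e_indep, of v] assms(1) by (simp add: V_eq)
  also have "\<dots> \<in> span {e B}"
  proof (rule span_sum)
    fix x assume x: "x \<in> {x. representation (e ` I) v x \<noteq> 0}"
    then have "x \<in> e ` I"
      using representation_ne_zero by auto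
    with x assms(2) have "x = e B"
      by (auto simp: coord_def)
    then show "scale (representation (e ` I) v x) x \<in> span {e B}"
      by (simp add: span_base span_scale)
  qed
  finally show ?thesis .
qed

lemma eq_zeroI:
  assumes "v \<in> Vsp M" "\<And>A. A \<in> I \<Longrightarrow> coord v A = 0"
  shows "v = 0"
proof -
  have "v = (\<Sum>x | representation (e ` I) v x \<noteq> 0. scale (representation (e ` I) v x) x)"
    using sum_nonzero_representation_eq[OF e_indep, of v] assms(1) by (simp add: V_eq)
  also have "{x. representation (e ` I) v x \<noteq> 0} = {}"
    using assms(2) representation_ne_zero by (fastforce simp: coord_def)
  finally show ?thesis by simp
qed

lemma coord_diagonal:
  assumes "module_hom scale scale f" "\<And>B. B \<in> I \<Longrightarrow> f (e B) = scale (g B) (e B)"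
    and "A \<in> I" "v \<in> Vsp M"
  shows "f v \<in> Vsp M \<and> coord (f v) A = g A * coord v A"
proof -
  have "v \<in> span (e ` I)"
    using assms(4) by (simp add: V_eq)
  then have "v \<in> Vsp M \<and> f v \<in> Vsp M \<and> coord (f v) A = g A * coord v A"
  proof (induction rule: span_induct_alt)
    case base
    show ?case
      using assms(1) by (simp add: module_hom.zero coord_zero zero_in_V)
  next
    case (step b x y)
    then obtain B where B: "B \<in> I" "x = e B" by auto
    have "f (scale b x + y) = scale (b * g B) (e B) + f y"
      using assms(1) B by (simp add: module_hom.add module_hom.scale assms(2))
    moreover have "coord (scale r (e B) + u) A = r * of_bool (A = B) + coord u A"
      if "u \<in> Vsp M" for r u
      using that B assms(3) by (simp add: coord_add coord_scale coord_e scale_in_V e_in_V)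
    ultimately show ?case
      using step B e_in_V[OF B(1)] by (auto simp: V_eq span_add span_scale distrib_left)
  qed
  then show ?thesis by simp
qed

lemma cartan_ops_diagonal:
  assumes "f \<in> cartan_ops"
  shows "module_hom scale scale f \<and> (\<forall>A \<in> I. \<exists>b. f (e A) = scale b (e A))"
  using assms
proof induction
  case one
  show ?case
    by (auto simp: lin_ident intro: exI[of _ 1])
next
  case (K h)
  show ?case
    using K_lin by (blast intro: K_e)
next
  case (H m i)
  show ?case
    using H_lin by (blast intro: H_e)
next
  case (scale f b)
  have "\<exists>b'. scale b (f (e A)) = scale b' (e A)" if A: "A \<in> I" for A
  proof -
    obtain b' where "f (e A) = scale b' (e A)"
      using scale.IH[THEN conjunct2, rule_format, OF A] ..
    then have "scale b (f (e A)) = scale (b * b') (e A)"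
      by simp
    then show ?thesis ..
  qed
  moreover have "module_hom scale scale (\<lambda>v. scale b (f v))"
    by (rule lin_scale[OF scale.IH[THEN conjunct1]])
  ultimately show ?case by blast
next
  case (add f g)
  have "\<exists>b. f (e A) + g (e A) = scale b (e A)" if A: "A \<in> I" for A
  proof -
    obtain b where "f (e A) = scale b (e A)"
      using add.IH(1)[THEN conjunct2, rule_format, OF A] ..
    moreover obtain b' where "g (e A) = scale b' (e A)"
      using add.IH(2)[THEN conjunct2, rule_format, OF A] ..
    ultimately have "f (e A) + g (e A) = scale (b + b') (e A)"
      by (simp add: scale_left_distrib)
    then show ?thesis ..
  qed
  moreover have "module_hom scale scale (\<lambda>v. f v + g v)"
    by (rule lin_add[OF add.IH[THEN conjunct1]])
  ultimately show ?case by blast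
next
  case (mult f g)
  have "\<exists>b. f (g (e A)) = scale b (e A)" if A: "A \<in> I" for A
  proof -
    obtain b where "f (e A) = scale b (e A)"
      using mult.IH(1)[THEN conjunct2, rule_format, OF A] ..
    moreover obtain b' where "g (e A) = scale b' (e A)"
      using mult.IH(2)[THEN conjunct2, rule_format, OF A] ..
    moreover have "f (scale b' (e A)) = scale b' (f (e A))"
      by (rule module_hom.scale[OF mult.IH(1)[THEN conjunct1]])
    ultimately have "f (g (e A)) = scale (b' * b) (e A)"
      by simp
    then show ?thesis ..
  qed
  moreover have "module_hom scale scale (\<lambda>v. f (g v))"
    by (rule lin_comp[OF mult.IH[THEN conjunct1]])
  ultimately show ?case by blast
qed

lemma joint_eigenvector:
  assumes "A \<in> I"
  shows "e A \<in> (\<Union>\<chi>. joint_eigenspace \<chi>)"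
proof -
  \<comment> \<open>A point of the joint spectrum is any function on \<open>cartan_ops\<close>, so
    eigenvalues may be chosen operator by operator.\<close>
  define \<chi> where "\<chi> f = (SOME b. f (e A) = scale b (e A))" for f
  have "f (e A) = scale (\<chi> f) (e A)" if f: "f \<in> cartan_ops" for f
    unfolding \<chi>_def
    by (rule someI_ex) (rule cartan_ops_diagonal[OF f, THEN conjunct2, rule_format, OF assms])
  then have "e A \<in> joint_eigenspace \<chi>"
    using e_in_V[OF assms] by (simp add: joint_eigenspace_def)
  then show ?thesis by blast
qed

lemma q_powi_inj: "q powi k = q powi k' \<Longrightarrow> k = k'"
  using q_powi_neq_1[of "k - k'"] by (cases "k = k'") (auto simp: power_int_diff)

lemma thin: thin
  unfolding thin_def
proof (intro conjI allI)
  have "(\<Union>\<chi>. joint_eigenspace \<chi>) \<subseteq> Vsp M"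
    by (auto simp: joint_eigenspace_def)
  moreover have "e ` I \<subseteq> (\<Union>\<chi>. joint_eigenspace \<chi>)"
    using joint_eigenvector by blast
  ultimately show "span (\<Union>\<chi>. joint_eigenspace \<chi>) = Vsp M"
    unfolding V_eq by (metis span_mono span_span subset_antisym)
next
  fix \<chi>
  show "\<exists>v. joint_eigenspace \<chi> \<subseteq> span {v}"
  proof (cases "joint_eigenspace \<chi> \<subseteq> {0}")
    case True
    then show ?thesis
      by (intro exI[of _ 0]) auto
  next
    case False
    define K where "K i = Kop M (Poly_Mapping.single i 1)" for i
    \<comment> \<open>Every basis vector occurring in some vector of the eigenspace has the weight
      prescribed by \<chi>. Two such basis vectors therefore belong to the same set.\<close>
    have weight: "\<chi> (K i) = q powi wt_coeff i A"
      if "A \<in> I" "v \<in> joint_eigenspace \<chi>" "coord v A \<noteq> 0" for A v i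
    proof -
      have v: "v \<in> Vsp M" "K i v = scale (\<chi> (K i)) v"
        using that(2) by (auto simp: joint_eigenspace_def K_def intro: cartan_ops.K)
      have "coord (K i v) A = q powi wt_coeff i A * coord v A"
        using coord_diagonal[OF K_lin K_e that(1) v(1)]
        by (simp add: K_def set_wt_single qpow_of_int)
      with v that show ?thesis
        by (simp add: coord_scale)
    qed
    from False obtain w where w: "w \<in> joint_eigenspace \<chi>" "w \<noteq> 0" by auto
    then obtain B where B: "B \<in> I" "coord w B \<noteq> 0"
      using eq_zeroI[of w] by (auto simp: joint_eigenspace_def)
    have "v \<in> span {e B}" if v: "v \<in> joint_eigenspace \<chi>" for v
    proof (rule in_span_single)
      show "v \<in> Vsp M"
        using v by (simp add: joint_eigenspace_def)
    next
      fix A assume A: "A \<in> I" "A \<noteq> B"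
      show "coord v A = 0"
      proof (rule ccontr)
        assume "coord v A \<noteq> 0"
        then have "wt_coeff i A = wt_coeff i B" for i
          using weight[OF A(1) v] weight[OF B(1) w(1) B(2)] by (intro q_powi_inj) metis
        then show False
          using wt_coeff_determines_set[of A B] I_fin A B(1) by blast
      qed
    qed (rule B(1))
    then show ?thesis by blast
  qed
qed

text \<open>The \<open>phi s i n\<close> are diagonal in the basis, so a power of the shifted
  operator multiplies each coordinate by a power of the difference of eigenvalues. Generalized
  eigenvectors are thus eigenvectors, and k = 1 suffices.\<close>

lemma gen_eigenspace_eq:
  "gen_eigenspace m = {v \<in> Vsp M. \<forall>A \<in> I. coord v A \<noteq> 0 \<longrightarrow>
     (\<forall>s i n. fls_nth (lweight fls_const (zvar s) q m i) (int n) =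
       phi_coeff q s (wt_coeff i A) (c i A) (sg s * int n))}"
    (is "_ = {v \<in> Vsp M. \<forall>A \<in> I. coord v A \<noteq> 0 \<longrightarrow> (\<forall>s i n. ?L s i n = ?P s i n A)}")
proof -
  define f where "f s i n u = phi s i n u - scale (?L s i n) u" for s i n u
  have lin: "module_hom scale scale (f s i n)" for s i n
    unfolding f_def by (intro lin_diff lin_phi lin_scale lin_ident)
  have f_e: "f s i n (e A) = scale (?P s i n A - ?L s i n) (e A)" if "A \<in> I" for s i n A
    using that by (simp add: f_def phi_e scale_left_diff_distrib)
  have pow: "(f s i n ^^ k) v \<in> Vsp M \<and>
      coord ((f s i n ^^ k) v) A = (?P s i n A - ?L s i n) ^ k * coord v A"
    if "v \<in> Vsp M" "A \<in> I" for s i n k v A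
    using that coord_diagonal[OF lin f_e that(2)] by (induction k) auto
  have "(\<exists>k. (f s i n ^^ k) v = 0) \<longleftrightarrow> (\<forall>A \<in> I. coord v A \<noteq> 0 \<longrightarrow> ?L s i n = ?P s i n A)"
    if "v \<in> Vsp M" for s i n v
  proof
    assume "\<exists>k. (f s i n ^^ k) v = 0"
    then obtain k where "(f s i n ^^ k) v = 0" ..
    then have "(?P s i n A - ?L s i n) ^ k * coord v A = 0" if "A \<in> I" for A
      using pow[OF \<open>v \<in> Vsp M\<close> that, where s = s and i = i and n = n and k = k] by (simp add: coord_zero)
    then show "\<forall>A \<in> I. coord v A \<noteq> 0 \<longrightarrow> ?L s i n = ?P s i n A"
      by fastforce
  next
    assume "\<forall>A \<in> I. coord v A \<noteq> 0 \<longrightarrow> ?L s i n = ?P s i n A"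
    then have "coord (f s i n v) A = 0" if "A \<in> I" for A
      using coord_diagonal[OF lin f_e that \<open>v \<in> Vsp M\<close>] that by auto
    moreover have "f s i n v \<in> Vsp M"
      by (rule closed[OF lin _ that]) (simp add: f_e e_in_V scale_in_V)
    ultimately have "(f s i n ^^ 1) v = 0"
      using eq_zeroI by simp
    then show "\<exists>k. (f s i n ^^ k) v = 0" ..
  qed
  then show ?thesis
    unfolding gen_eigenspace_def f_def by blast
qed

text \<open>The constant term of \<phi>_i^+ is q^\<epsilon>, so it already yields the
  weight.\<close>

lemma phi_coeff_determines_set:
  assumes "A \<in> I" "B \<in> I"
    and eq: "\<And>i. phi_coeff q Plus (wt_coeff i A) (c i A) 0 = phi_coeff q Plus (wt_coeff i B) (c i B) 0"
  shows "A = B"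
proof -
  have "q powi wt_coeff i A = q powi wt_coeff i B" for i
    using eq[of i] wt_coeff_cases[of i A] wt_coeff_cases[of i B]
    by (auto simp: phi_coeff_def power_int_minus)
  then show ?thesis
    using wt_coeff_determines_set I_fin assms(1,2) q_powi_inj by metis
qed

lemma edim_gen_eigenspace:
  "edim (gen_eigenspace m) =
    (if \<exists>A \<in> I. \<forall>s i n. fls_nth (lweight fls_const (zvar s) q m i) (int n) =
       phi_coeff q s (wt_coeff i A) (c i A) (sg s * int n) then 1 else 0)"
    (is "_ = (if \<exists>A \<in> I. ?P A then 1 else 0)")
proof (cases "\<exists>A \<in> I. ?P A")
  case True
  then obtain A where A: "A \<in> I" "?P A" by blast
  have uniq: "B = A" if B: "B \<in> I" "?P B" for B
  proof (rule phi_coeff_determines_set[OF B(1) A(1)])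
    show "phi_coeff q Plus (wt_coeff i B) (c i B) 0 = phi_coeff q Plus (wt_coeff i A) (c i A) 0" for i
      using A(2)[rule_format, of Plus i 0] B(2)[rule_format, of Plus i 0] by simp
  qed
  have "gen_eigenspace m = span {e A}"
  proof (intro equalityI subsetI)
    fix v assume v: "v \<in> gen_eigenspace m"
    then have "coord v B = 0" if "B \<in> I" "B \<noteq> A" for B
      using that uniq unfolding gen_eigenspace_eq by blast
    then show "v \<in> span {e A}"
      using v A(1) by (intro in_span_single) (auto simp: gen_eigenspace_eq)
  next
    fix v assume "v \<in> span {e A}"
    then obtain b where v: "v = scale b (e A)"
      by (auto simp: span_singleton)
    have "coord v B = 0" if "B \<in> I" "B \<noteq> A" for B
      using that A(1) by (simp add: v coord_scale e_in_V coord_e)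
    then show "v \<in> gen_eigenspace m"
      using A unfolding gen_eigenspace_eq by (auto simp: v e_in_V scale_in_V)
  qed
  moreover have "dim (span {e A}) = 1"
    using dim_span_eq_card_independent[OF independent_mono[OF e_indep, of "{e A}"]] A(1) by simp
  ultimately show ?thesis
    using True unfolding edim_def by (auto simp: one_enat_def intro: exI[of _ "{e A}"])
next
  case False
  have "v = 0" if "v \<in> gen_eigenspace m" for v
  proof (rule eq_zeroI)
    show "v \<in> Vsp M" "\<And>A. A \<in> I \<Longrightarrow> coord v A = 0"
      using that False unfolding gen_eigenspace_eq by blast+
  qed
  moreover have "0 \<in> gen_eigenspace m"
    by (simp add: gen_eigenspace_eq coord_zero zero_in_V)
  ultimately have "gen_eigenspace m = {0}"
    by blast
  then have "gen_eigenspace m = span {}"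
    by simp
  moreover have "dim (span {}) = 0"
    by (metis card.empty dim_span_eq_card_independent independent_empty)
  ultimately show ?thesis
    using False unfolding edim_def by (auto simp: zero_enat_def intro: exI[of _ "{}"])
qed

end

section \<open>Monomials and their l-weights\<close>

lemma psi_zvar_nonzero:
  assumes "q \<noteq> 0"
  shows "psi (fls_const q) (fls_const b * zvar s) \<noteq> 0"
proof -
  have nz: "psi (fls_const u) (fls_const b * fls_X) \<noteq> 0" if "u \<noteq> 0" for u b :: complex
    using that by (auto simp: psi_fls_X fps_eq_iff intro: exI[of _ 0])
  show ?thesis
  proof (cases "b = 0 \<or> s = Plus")
    case True
    with assms nz show ?thesis
      by (cases s) (auto simp: psi_def fls_const_nonzero)
  next
    case False
    then have "s = Minus" "b \<noteq> 0"
      by (cases s; simp)+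
    have "psi (fls_const q) (inverse (fls_const (inverse b) * fls_X)) =
        psi (fls_const (inverse q)) (fls_const (inverse b) * fls_X)"
      using assms \<open>b \<noteq> 0\<close> by (subst psi_inverse_arg) (auto simp: fls_const_nonzero fls_inverse_const)
    with assms nz[of "inverse q"] \<open>s = Minus\<close> show ?thesis
      by (simp add: fls_inverse_const fls_inverse_X)
  qed
qed

text \<open>Guarantees that l-weights have no negative powers of z, so that the coefficients
  compared in \<open>gen_eigenspace\<close> determine them.\<close>

lemma subdegree_psi_fls_X:
  fixes q b :: complex
  assumes "q \<noteq> 0"
  shows "fls_subdegree (psi (fls_const q) (fls_const b * fls_X)) = 0"
proof -
  have "subdegree (Abs_fps (\<lambda>n. if n = 0 then q else (q - inverse q) * b ^ n)) = 0"
    using assms by (intro subdegree_eq_0) simp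
  then show ?thesis
    unfolding psi_fls_X[OF assms] fls_subdegree_fls_to_fps by simp
qed

lemma lweight_superset:
  assumes "finite F" "{b. (i, b) \<in> Poly_Mapping.keys m} \<subseteq> F"
  shows "lweight \<iota> z q m i = (\<Prod>b\<in>F. psi (\<iota> q) (\<iota> (b * q) * z) powi Poly_Mapping.lookup m (i, b))"
  unfolding lweight_def using assms
  by (intro prod.mono_neutral_left) (auto simp: in_keys_iff)

lemma finite_keys_section: "finite {b. (i, b) \<in> Poly_Mapping.keys m}"
proof -
  have "{b. (i, b) \<in> Poly_Mapping.keys m} \<subseteq> snd ` Poly_Mapping.keys m"
    by force
  then show ?thesis
    by (rule finite_subset) simp
qed

lemma lweight_zero [simp]: "lweight \<iota> z q 0 i = 1"
  by (simp add: lweight_def)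

lemma lweight_add:
  assumes "q \<noteq> 0"
  shows "lweight fls_const (zvar s) q (m + m') i =
    lweight fls_const (zvar s) q m i * lweight fls_const (zvar s) q m' i"
proof -
  let ?S = "\<lambda>m. {b. (i, b) \<in> Poly_Mapping.keys m}"
  let ?F = "?S m \<union> ?S m'"
  have F: "finite ?F" "?S (m + m') \<subseteq> ?F"
    using keys_add[of m m'] by (auto simp: finite_keys_section)
  show ?thesis
    using F by (simp add: lweight_superset[of ?F] lookup_add power_int_add psi_zvar_nonzero assms
        prod.distrib)
qed

lemma lweight_uminus:
  "lweight fls_const (zvar s) q (- m) i = inverse (lweight fls_const (zvar s) q m i)"
  by (simp add: lweight_def power_int_minus prod_inversef[symmetric] o_def)

lemma lweight_diff:
  assumes "q \<noteq> 0"
  shows "lweight fls_const (zvar s) q (m - m') i =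
    lweight fls_const (zvar s) q m i * inverse (lweight fls_const (zvar s) q m' i)"
  using lweight_add[OF assms, of s m "- m'" i] by (simp add: lweight_uminus)

lemma lweight_Yvar:
  "lweight fls_const (zvar s) q (Yvar j b) i =
    (if i = j then psi (fls_const q) (fls_const (b * q) * zvar s) else 1)"
proof -
  have "{b'. (i, b') \<in> Poly_Mapping.keys (Yvar j b)} = (if i = j then {b} else {})"
    by (auto simp: Yvar_def)
  then show ?thesis
    by (simp add: lweight_def Yvar_def)
qed

lemma lweight_sum:
  assumes "q \<noteq> 0"
  shows "lweight fls_const (zvar s) q (\<Sum>j\<in>J. f j) i = (\<Prod>j\<in>J. lweight fls_const (zvar s) q (f j) i)"
  by (induction J rule: infinite_finite_induct) (simp_all add: lweight_add assms)

text \<open>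
  If \<open>d b \<noteq> 0\<close> but \<open>d (b q\<^sup>2) = 0\<close>, then the pole of \<open>\<psi>(b q z)\<close> at \<open>z = 1 / (b q)\<close> cancels
  against no other factor of \<open>\<Prod>b. \<psi>(b q z)\<^bsup>d b\<^esup>\<close>. Such a \<open>b\<close> exists because the support of \<open>d\<close> is
  finite.
\<close>

lemma lweight_eq_1_imp_zero:
  assumes q0: "q \<noteq> 0" and q_not_root: "\<And>n::nat. n \<ge> 1 \<Longrightarrow> q ^ n \<noteq> 1"
    and m: "m \<in> ymonoms"
    and one: "\<And>i. lweight fls_const (zvar Plus) q m i = 1"
  shows "m = 0"
proof (rule ccontr)
  assume "m \<noteq> 0"
  then have "Poly_Mapping.keys m \<noteq> {}"
    by simp
  then obtain x where "x \<in> Poly_Mapping.keys m"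
    by blast
  then obtain i b0 where b0: "(i, b0) \<in> Poly_Mapping.keys m"
    by (cases x) auto
  define B where "B = {b. (i, b) \<in> Poly_Mapping.keys m}"
  define d where "d b = Poly_Mapping.lookup m (i, b)" for b
  have finB: "finite B"
    unfolding B_def by (rule finite_keys_section)
  have B0: "b \<noteq> 0" if "b \<in> B" for b
    using that m by (auto simp: B_def ymonoms_def)
  have dB: "d b \<noteq> 0" if "b \<in> B" for b
    using that by (auto simp: B_def d_def in_keys_iff)
  \<comment> \<open>Otherwise the orbit b0 q^(2 n) would be an infinite subset of the finite set
    \<open>B\<close>.\<close>
  have "\<exists>b\<in>B. b * q ^ 2 \<notin> B"
  proof (rule ccontr)
    assume "\<not> ?thesis"
    then have step: "b * q ^ 2 \<in> B" if "b \<in> B" for b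
      using that by blast
    have "b0 * (q ^ 2) ^ n \<in> B" for n
    proof (induction n)
      case (Suc n)
      then show ?case using step[OF Suc] by (simp add: mult_ac)
    qed (use b0 in \<open>simp add: B_def\<close>)
    then have "range (\<lambda>n::nat. b0 * (q ^ 2) ^ n) \<subseteq> B"
      by blast
    moreover have "inj (\<lambda>n::nat. b0 * (q ^ 2) ^ n)"
    proof (rule linorder_injI)
      fix n k :: nat
      assume "n < k"
      have "q ^ (2 * (k - n)) \<noteq> 1"
        using \<open>n < k\<close> by (intro q_not_root) simp
      moreover have "(q ^ 2) ^ k = (q ^ 2) ^ n * q ^ (2 * (k - n))"
      proof -
        have "2 * k = 2 * n + 2 * (k - n)"
          using \<open>n < k\<close> by simp
        from arg_cong[OF this, of "power q"] have "q ^ (2 * k) = q ^ (2 * n) * q ^ (2 * (k - n))"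
          by (simp only: power_add)
        then show ?thesis
          by (simp only: power_mult[symmetric])
      qed
      ultimately show "b0 * (q ^ 2) ^ n \<noteq> b0 * (q ^ 2) ^ k"
        using B0[of b0] b0 q0 by (simp add: B_def)
    qed
    ultimately show False
      using finB finite_imageD finite_subset infinite_UNIV_nat by blast
  qed
  then obtain b where b: "b \<in> B" "b * q ^ 2 \<notin> B" by blast
  define N where "N b = [:q, - b:]" for b
  define D where "D b = [:1, - (b * q):]" for b
  define E where "E p = fps_to_fls (fps_of_poly p)" for p :: "complex poly"
  have E_eq: "E p = E p' \<longleftrightarrow> p = p'" for p p'
    by (simp add: E_def fps_of_poly_eq_iff)
  have E_prod: "E (\<Prod>b\<in>B. f b) = (\<Prod>b\<in>B. E (f b))" for f
    using finB by (induction B rule: finite_induct)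
      (simp_all add: E_def fps_of_poly_mult fls_times_fps_to_fls)
  have E_power: "E (p ^ n) = E p ^ n" for p n
    by (simp add: E_def fps_of_poly_power fps_to_fls_power)
  have E_pCons: "E [:x, y:] = fls_const x + fls_const y * fls_X" for x y
    by (simp add: E_def fps_of_poly_pCons fls_times_fps_to_fls)
  have ED: "E (D b) \<noteq> 0" and EN: "E (N b) \<noteq> 0" for b
    using E_eq[of _ 0] q0 by (auto simp: D_def N_def E_def)
  have psi: "psi (fls_const q) (fls_const (b * q) * zvar Plus) = E (N b) / E (D b)" for b
  proof -
    have *: "inverse (fls_const q) * (fls_const (b * q) * fls_X) = fls_const b * fls_X"
      unfolding fls_inverse_const mult.assoc[symmetric] fls_const_mult_const using q0 by (simp add: mult_ac)
    show ?thesis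
      unfolding psi_def zvar.simps * N_def D_def E_pCons by simp
  qed
  \<comment> \<open>Factors with negative exponent change sides, which turns the hypothesis into an
    identity of polynomials whose roots can be compared.\<close>
  define num where "num b = (if 0 < d b then N b ^ nat (d b) else D b ^ nat (- d b))" for b
  define den where "den b = (if 0 < d b then D b ^ nat (d b) else N b ^ nat (- d b))" for b
  have quot: "(E (N b) / E (D b)) powi d b = E (num b) / E (den b)" for b
    using ED EN by (auto simp: num_def den_def E_power power_int_def power_divide field_simps)
  have den_nz: "E (den b) \<noteq> 0" for b
    using ED EN by (simp add: den_def E_power)
  have "1 = (\<Prod>b\<in>B. E (num b) / E (den b))"
    using one[of i] unfolding lweight_def B_def[symmetric] d_def[symmetric] psi quot by simp
  then have "E (\<Prod>b\<in>B. num b) = E (\<Prod>b\<in>B. den b)"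
    using den_nz finB by (simp add: prod_dividef E_prod)
  then have eq: "(\<Prod>b\<in>B. num b) = (\<Prod>b\<in>B. den b)"
    by (simp add: E_eq)
  \<comment> \<open>The root of \<open>D b\<close>. No other \<open>D b'\<close> vanishes there, and
    \<open>N b'\<close> only for b' = b q^2, which is not in \<open>B\<close>.\<close>
  define z where "z = inverse (b * q)"
  have bz: "b \<noteq> 0"
    using B0 b(1) .
  have D_root: "b' = b" if "poly (D b') z = 0" for b'
    using that bz q0 by (simp add: D_def z_def field_simps)
  have D_root': "poly (D b) z = 0"
    using bz q0 by (simp add: D_def z_def field_simps)
  have N_root: "b' = b * q ^ 2" if "poly (N b') z = 0" for b'
    using that bz q0 by (simp add: N_def z_def field_simps power2_eq_square)
  have roots: "poly (\<Prod>b\<in>B. f b) z = 0 \<longleftrightarrow> (\<exists>b\<in>B. poly (f b) z = 0)" for f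
    using finB by (simp add: poly_prod)
  consider "0 < d b" | "d b < 0"
    using dB[OF b(1)] by linarith
  then show False
  proof cases
    case 1
    then have "\<exists>b'\<in>B. poly (num b') z = 0"
      using eq roots[of num] roots[of den] b(1) D_root' by (force simp: den_def)
    then obtain b' where "b' \<in> B" "poly (num b') z = 0" by blast
    with 1 b(2) show False
      using N_root[of b'] D_root[of b'] by (auto simp: num_def split: if_splits)
  next
    case 2
    then have "\<exists>b'\<in>B. poly (den b') z = 0"
      using eq roots[of num] roots[of den] b(1) D_root' by (force simp: num_def)
    then obtain b' where "b' \<in> B" "poly (den b') z = 0" by blast
    with 2 b(2) show False
      using N_root[of b'] D_root[of b'] by (auto simp: den_def split: if_splits)
  qed
qed

lemma ymonoms_zero: "0 \<in> ymonoms"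
  by (simp add: ymonoms_def)

lemma ymonoms_add: "m \<in> ymonoms \<Longrightarrow> m' \<in> ymonoms \<Longrightarrow> m + m' \<in> ymonoms"
  using keys_add[of m m'] unfolding ymonoms_def by blast

lemma ymonoms_diff: "m \<in> ymonoms \<Longrightarrow> m' \<in> ymonoms \<Longrightarrow> m - m' \<in> ymonoms"
  using keys_diff[of m m'] unfolding ymonoms_def by blast

text \<open>The l-weight turns differences of monomials into quotients, so triviality of its kernel
  can be applied to m - m'.\<close>

lemma lweight_inj:
  assumes q0: "q \<noteq> 0" and q_not_root: "\<And>n::nat. n \<ge> 1 \<Longrightarrow> q ^ n \<noteq> 1"
    and m: "m \<in> ymonoms" "m' \<in> ymonoms"
    and eq: "\<And>i n. fls_nth (lweight fls_const (zvar Plus) q m i) (int n) =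
      fls_nth (lweight fls_const (zvar Plus) q m' i) (int n)"
  shows "m = m'"
proof -
  have nz: "lweight fls_const (zvar Plus) q m i \<noteq> 0" for m i
    unfolding lweight_def
    using psi_zvar_nonzero[OF q0, of _ Plus]
    unfolding prod_zero_iff[OF finite_keys_section] power_int_eq_0_iff by blast
  have subdeg: "fls_subdegree (lweight fls_const (zvar Plus) q m i) = 0" for m i
    unfolding lweight_def using psi_zvar_nonzero[OF q0, of _ Plus]
    by (subst fls_subdegree_prod) (auto simp: power_int_eq_0_iff subdegree_psi_fls_X[OF q0])
  have "lweight fls_const (zvar Plus) q m i = lweight fls_const (zvar Plus) q m' i" for i
  proof (rule fls_eqI)
    fix k
    show "fls_nth (lweight fls_const (zvar Plus) q m i) k =
        fls_nth (lweight fls_const (zvar Plus) q m' i) k"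
      using eq[of i "nat k"] subdeg by (cases "k < 0") auto
  qed
  then have "lweight fls_const (zvar Plus) q (m - m') i = 1" for i
    using nz[of m' i] unfolding lweight_diff[OF q0] by simp
  moreover have "m - m' \<in> ymonoms"
    using m by (rule ymonoms_diff)
  ultimately have "m - m' = 0"
    using lweight_eq_1_imp_zero[OF q0 q_not_root] by blast
  then show ?thesis by simp
qed

section \<open>Finite sequences, their value sets and their monomials\<close>

lemma seqs_finD:
  assumes "S \<in> seqs_fin l"
  shows "inj_on S {1..l}" and "\<And>p p'. p \<in> {1..l} \<Longrightarrow> p' \<in> {1..l} \<Longrightarrow> S p < S p' \<longleftrightarrow> p < p'"
proof -
  have mono: "strict_mono_on {1..l} S"
    using assms by (simp add: seqs_fin_def)
  then show "inj_on S {1..l}"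
    by (rule strict_mono_on_imp_inj_on)
  show "\<And>p p'. p \<in> {1..l} \<Longrightarrow> p' \<in> {1..l} \<Longrightarrow> S p < S p' \<longleftrightarrow> p < p'"
    by (rule strict_mono_on_less[OF mono])
qed

lemma card_below:
  assumes S: "S \<in> seqs_fin l" and p: "p \<in> {1..l}"
  shows "int (card {x \<in> S ` {1..l}. x < S p}) = p - 1"
proof -
  have "{x \<in> S ` {1..l}. x < S p} = S ` {r \<in> {1..l}. S r < S p}"
    by auto
  also have "{r \<in> {1..l}. S r < S p} = {1..p - 1}"
    using p by (auto simp: seqs_finD(2)[OF S])
  finally have "{x \<in> S ` {1..l}. x < S p} = S ` {1..p - 1}" .
  moreover have "inj_on S {1..p - 1}"
    by (rule inj_on_subset[OF seqs_finD(1)[OF S]]) (use p in auto)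
  ultimately show ?thesis
    using p by (simp add: card_image)
qed

text \<open>S p is the p-th smallest value. The result is the argument of \<psi> that the box of S p
  at index p contributes to the l-weight at S p.\<close>

lemma spec_index:
  assumes S: "S \<in> seqs_fin l" and p: "p \<in> {1..l}"
  shows "spec q l a (S p) (S ` {1..l}) = a * q powi (l + S p + 1 - 2 * p)"
proof -
  have "l + S p - 1 - 2 * int (card {x \<in> S ` {1..l}. x < S p}) = l + S p + 1 - 2 * p"
    using card_below[OF assms] by simp
  then show ?thesis
    by (simp only: spec_def)
qed

text \<open>The number of smaller values fixes the index of a value and is strictly increasing on
  the value set.\<close>

lemma seqs_fin_image_inj:
  assumes S: "S \<in> seqs_fin l" and S': "S' \<in> seqs_fin l" and eq: "S ` {1..l} = S' ` {1..l}"
  shows "S = S'"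
proof -
  have "S p = S' p" if p: "p \<in> {1..l}" for p
  proof -
    let ?n = "\<lambda>y. card {x \<in> S ` {1..l}. x < y}"
    have less: "?n y < ?n y'" if "y < y'" "y \<in> S ` {1..l}" for y y'
    proof (rule psubset_card_mono)
      show "{x \<in> S ` {1..l}. x < y} \<subset> {x \<in> S ` {1..l}. x < y'}"
        using that by (intro psubsetI subsetI) auto
    qed simp
    have "?n (S p) = ?n (S' p)"
      using card_below[OF S p] card_below[OF S' p] unfolding eq by linarith
    moreover have "S p \<in> S ` {1..l}" "S' p \<in> S ` {1..l}"
      using imageI[OF p, of S] imageI[OF p, of S'] eq by simp_all
    ultimately show ?thesis
      using less[of "S p" "S' p"] less[of "S' p" "S p"] by linarith
  qed
  then show ?thesis
    using S S' by (auto simp: seqs_fin_def intro: extensionalityI)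
qed

lemma mT_in_ymonoms:
  assumes "q \<noteq> 0" "a \<noteq> 0"
  shows "mT q l a S \<in> ymonoms"
proof -
  have Yvar: "Yvar i b \<in> ymonoms" if "b \<noteq> 0" for i b
    using that by (simp add: ymonoms_def Yvar_def)
  have box: "box q x b \<in> ymonoms" if "b \<noteq> 0" for x b
    using that assms ymonoms_diff[OF Yvar Yvar] by (simp add: box_def)
  have "sum f J \<in> ymonoms" if "\<And>j. f j \<in> ymonoms" for f :: "int \<Rightarrow> ymonom" and J
    using that by (induction J rule: infinite_finite_induct) (simp_all add: ymonoms_add ymonoms_zero)
  with box assms show ?thesis
    by (simp add: mT_def)
qed

lemma prod_delta_image:
  assumes "finite D" "inj_on S D"
  shows "(\<Prod>j\<in>D. if S j = y then g j else 1) =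
    (if y \<in> S ` D then g (the_inv_into D S y) else (1::'a::comm_monoid_mult))"
proof (cases "y \<in> S ` D")
  case True
  then obtain p where p: "p \<in> D" "y = S p" by auto
  then have "(\<Prod>j\<in>D. if S j = y then g j else 1) = (\<Prod>j\<in>D. if j = p then g j else 1)"
    using assms(2) by (intro prod.cong) (auto simp: inj_on_eq_iff)
  with p assms show ?thesis
    by (simp add: the_inv_into_f_f)
qed (auto intro!: prod.neutral)

text \<open>Only the boxes of i and i + 1 contribute, with \<psi> and an inverse \<psi>. By
  \<open>spec_Suc\<close> the argument of the latter is c if i is in A, so the two cancel, and c q^2
  if not, as in \<open>eps_phi\<close>.\<close>

lemma lweight_mT:
  assumes S: "S \<in> seqs_fin l" and q0: "q \<noteq> 0"
  defines "A \<equiv> S ` {1..l}"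
  shows "lweight fls_const (zvar s) q (mT q l a S) i =
    eps_phi fls_const (zvar s) q (spec q l a i A) (wt_coeff i A)"
proof -
  define P where "P b = psi (fls_const q) (fls_const b * zvar s)" for b
  note inj = seqs_finD(1)[OF S]
  have P_nz: "P b \<noteq> 0" for b
    unfolding P_def by (rule psi_zvar_nonzero[OF q0])
  have "lweight fls_const (zvar s) q (mT q l a S) i =
      (\<Prod>j = 1..l. (if S j = i then P (a * q powi (l + i + 1 - 2 * j)) else 1) *
        (if S j = i + 1 then inverse (P (a * q powi (l + (i + 1) + 1 - 2 * j) * q)) else 1))"
    unfolding mT_def lweight_sum[OF q0]
  proof (rule prod.cong)
    fix j
    have pow: "q powi (l + 1 - 2 * j) * q powi x = q powi (l + x + 1 - 2 * j)" for x
      using q0 power_int_add[of q "l + 1 - 2 * j" x] by (simp add: algebra_simps)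
    have "q powi (i - 1) * q = q powi i"
      using q0 power_int_add[of q "i - 1" 1] by simp
    with pow[of "i + 1"] pow[of i] have
      "q powi (l + 1 - 2 * j) * q powi (i + 1) = q powi (l + (i + 1) + 1 - 2 * j)"
      "q powi (l + 1 - 2 * j) * (q powi (i - 1) * q) = q powi (l + i + 1 - 2 * j)"
      by simp_all
    then show "lweight fls_const (zvar s) q (box q (S j) (a * q powi (l + 1 - 2 * j))) i =
      (if S j = i then P (a * q powi (l + i + 1 - 2 * j)) else 1) *
        (if S j = i + 1 then inverse (P (a * q powi (l + (i + 1) + 1 - 2 * j) * q)) else 1)"
      by (auto simp: box_def lweight_diff[OF q0] lweight_Yvar P_def mult.assoc)
  qed simp
  also have "\<dots> = (if i \<in> A then P (spec q l a i A) else 1) *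
      (if i + 1 \<in> A then inverse (P (spec q l a (i + 1) A * q)) else 1)"
  proof -
    have "spec q l a y A = a * q powi (l + y + 1 - 2 * the_inv_into {1..l} S y)" if "y \<in> A" for y
      using spec_index[OF S, of "the_inv_into {1..l} S y" q a] that
        the_inv_into_into[OF inj _ subset_refl, of y] f_the_inv_into_f[OF inj, of y]
      unfolding A_def by simp
    then show ?thesis
      by (simp add: prod.distrib prod_delta_image inj flip: A_def)
  qed
  also have "\<dots> = eps_phi fls_const (zvar s) q (spec q l a i A) (wt_coeff i A)"
  proof -
    have cancel: "q * (inverse q * x) = x" for x
      using q0 by simp
    show ?thesis
      using spec_Suc[of A q l a i] q0 P_nz
      by (auto simp: A_def eps_phi_def wt_coeff_def P_def power2_eq_square mult_ac cancel)
  qed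
  finally show ?thesis .
qed

section \<open>The action on the tensor product\<close>

lemma lookup_fscale [simp]:
  "Poly_Mapping.lookup (fscale b v) x = b * Poly_Mapping.lookup v x"
  by (simp add: fscale_def Poly_Mapping.map.rep_eq when_def)

interpretation fs: vector_space fscale
  by unfold_locales (simp_all add: poly_mapping_eq_iff fun_eq_iff lookup_add algebra_simps)

lemma lin_ext_superset:
  assumes "finite F" "Poly_Mapping.keys v \<subseteq> F"
  shows "lin_ext f v = (\<Sum>B\<in>F. fscale (Poly_Mapping.lookup v B) (f B))"
  unfolding lin_ext_def using assms
  by (intro sum.mono_neutral_left) (auto simp: in_keys_iff)

lemma lin_ext_bvec [simp]: "lin_ext f (bvec B) = f B"
  by (simp add: lin_ext_def bvec_def)

lemma lin_ext_hom: "module_hom fscale fscale (lin_ext f)"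
proof -
  have "lin_ext f (u + v) = lin_ext f u + lin_ext f v" for u v
  proof -
    let ?F = "Poly_Mapping.keys u \<union> Poly_Mapping.keys v"
    have F: "finite ?F" "Poly_Mapping.keys u \<subseteq> ?F" "Poly_Mapping.keys v \<subseteq> ?F"
      "Poly_Mapping.keys (u + v) \<subseteq> ?F"
      using keys_add[of u v] by auto
    show ?thesis
      unfolding lin_ext_superset[OF F(1,2)] lin_ext_superset[OF F(1,3)] lin_ext_superset[OF F(1,4)]
      by (simp add: lookup_add fs.scale_left_distrib sum.distrib)
  qed
  moreover have "lin_ext f (fscale b v) = fscale b (lin_ext f v)" for b v
  proof -
    have "Poly_Mapping.keys (fscale b v) \<subseteq> Poly_Mapping.keys v"
      by (auto simp: in_keys_iff)
    from lin_ext_superset[OF finite_keys this] show ?thesis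
      by (simp add: lin_ext_def fs.scale_sum_right)
  qed
  ultimately show ?thesis
    by (simp add: module_hom_iff fs.module_axioms)
qed

lemma bvec_eq_iff [simp]: "bvec B = bvec C \<longleftrightarrow> B = C"
  by (metis bvec_def lookup_single_eq lookup_single_not_eq zero_neq_one)

lemma independent_bvec: "fs.independent (bvec ` X)"
  unfolding fs.independent_explicit_module
proof (intro allI impI)
  fix t u v
  assume t: "finite t" "t \<subseteq> bvec ` X" "(\<Sum>w\<in>t. fscale (u w) w) = 0" "v \<in> t"
  then obtain B where B: "v = bvec B" by auto
  have "Poly_Mapping.lookup w B = of_bool (w = v)" if "w \<in> t" for w
    using that t(2) by (auto simp: B bvec_def lookup_single when_def)
  then have "Poly_Mapping.lookup (\<Sum>w\<in>t. fscale (u w) w) B = (\<Sum>w\<in>t. u w * of_bool (w = v))"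
    by (simp add: lookup_sum)
  with t show "u v = 0"
    by (simp add: of_bool_def if_distrib[of "(*) _"] cong: if_cong)
qed

lemma tens_zero [simp]: "tens 0 v = 0" "tens u 0 = 0"
  by (simp_all add: tens_def)

lemma keys_fscale_bvec: "Poly_Mapping.keys (fscale b (bvec B)) = (if b = 0 then {} else {B})"
  by (auto simp: bvec_def in_keys_iff lookup_single when_def split: if_splits)

lemma tens_fscale_bvec [simp]:
  "tens (fscale b (bvec B)) (bvec C) = fscale b (bvec (B, C))"
  "tens (bvec B) (fscale b (bvec C)) = fscale b (bvec (B, C))"
  by (simp_all add: tens_def keys_fscale_bvec) (simp_all add: bvec_def)

lemma fund_x_zero:
  assumes "entry_from s i \<notin> T ` D \<or> entry_to s i \<in> T ` D"
  shows "fund_x q D N b g s i r T = 0"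
proof -
  have "crystal_op D s i T = 0"
    using assms by (auto simp: crystal_op_def)
  then show ?thesis
    by (simp add: fund_x_def Let_def)
qed

lemma fund_x_index:
  assumes "inj_on T D" "p \<in> D" "T p = entry_from s i" "entry_to s i \<notin> T ` D"
  shows "fund_x q D N b g s i r T =
    fscale (g (inverse (b * q powi (i + N + 1 - 2 * p))) * (b * q powi (i + N + 1 - 2 * p)) powi r)
      (bvec (\<lambda>p\<in>D. if T p = entry_from s i then entry_to s i else T p))"
proof -
  have "{p \<in> D. T p = entry_from s i} = {p}"
    using assms(1-3) by (auto simp: inj_on_def)
  moreover have "entry_from s i \<in> T ` D"
    using assms(2,3) by (metis imageI)
  ultimately show ?thesis
    using assms(4) by (simp add: fund_x_def crystal_op_def Let_def)
qed

lemma index_of_eq: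
  assumes "inj_on T D" "p \<in> D"
  shows "index_of D T (T p) = p"
  unfolding index_of_def using assms by (auto simp: inj_on_eq_iff)

lemma fund_phi_eq_1:
  "i \<in> T ` D \<Longrightarrow> i + 1 \<in> T ` D \<Longrightarrow> fund_phi \<iota> z q D N b i T = 1"
  by (simp add: fund_phi_def)

text \<open>Integer values grow by at least 1 per step, so T p - p is nondecreasing; all comparisons
  of a sequence with the diagonal rest on this.\<close>

lemma strict_mono_on_gap:
  fixes T :: "int \<Rightarrow> int"
  assumes "strict_mono_on D T" "p \<le> p'" "{p..p'} \<subseteq> D"
  shows "T p + (p' - p) \<le> T p'"
  using assms(2,3)
proof (induction p' rule: int_ge_induct)
  case (step k)
  have "T k < T (k + 1)"
    using step by (intro strict_mono_onD[OF assms(1)]) auto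
  moreover have "{p..k} \<subseteq> D"
    using step.prems by (rule subset_trans[rotated]) auto
  then have "T p + (k - p) \<le> T k"
    by (rule step.IH)
  ultimately show ?case by simp
qed simp

section \<open>Two half-infinite sequences from a finite one\<close>

definition upper :: "int \<Rightarrow> iseq \<Rightarrow> iseq" where
  "upper l S = (\<lambda>p\<in>{..l}. if 1 \<le> p then max (S p) p else p)"

definition lower :: "int \<Rightarrow> iseq \<Rightarrow> iseq" where
  "lower l S = (\<lambda>p\<in>{1..}. if p \<le> l then min (S p) p else p)"

lemma strict_mono_on_upper:
  assumes "S \<in> seqs_fin l"
  shows "strict_mono_on {..l} (upper l S)"
proof (rule strict_mono_onI)
  fix p p' assume "p \<in> {..l}" "p' \<in> {..l}" "p < p'"
  then show "upper l S p < upper l S p'"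
    using seqs_finD(2)[OF assms, of p p'] by (auto simp: upper_def max_def)
qed

lemma strict_mono_on_lower:
  assumes "S \<in> seqs_fin l"
  shows "strict_mono_on {1..} (lower l S)"
proof (rule strict_mono_onI)
  fix p p' :: int assume "p \<in> {1..}" "p' \<in> {1..}" "p < p'"
  then show "lower l S p < lower l S p'"
    using seqs_finD(2)[OF assms, of p p'] by (auto simp: lower_def min_def)
qed

lemma upper_lower_inj:
  assumes "S \<in> seqs_fin l" "S' \<in> seqs_fin l" "upper l S = upper l S'" "lower l S = lower l S'"
  shows "S = S'"
proof (rule extensionalityI[of _ "{1..l}"])
  fix p assume p: "p \<in> {1..l}"
  \<comment> \<open>Maximum and minimum add up to S p + p.\<close>
  have "upper l S p + lower l S p = upper l S' p + lower l S' p"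
    using assms by simp
  with p show "S p = S' p"
    by (auto simp: upper_def lower_def max_def min_def split: if_splits)
qed (use assms in \<open>auto simp: seqs_fin_def\<close>)

text \<open>\<open>crystal_op\<close> replaces by value and \<open>S(p := y)\<close> by index;
  injectivity of \<open>upper l S\<close> reconciles the two.\<close>

lemma upper_upd:
  assumes "S \<in> seqs_fin l" "p \<in> {1..l}"
  shows "upper l (S(p := y)) =
    (\<lambda>p'\<in>{..l}. if upper l S p' = upper l S p then max y p else upper l S p')"
proof -
  have "upper l S p' = upper l S p \<longleftrightarrow> p' = p" if "p' \<in> {..l}" for p'
    using strict_mono_on_imp_inj_on[OF strict_mono_on_upper[OF assms(1)]] that assms(2)
    by (auto simp: inj_on_def)
  with assms(2) show ?thesis
    by (auto simp: upper_def fun_eq_iff restrict_def)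
qed

lemma lower_upd:
  assumes "S \<in> seqs_fin l" "p \<in> {1..l}"
  shows "lower l (S(p := y)) =
    (\<lambda>p'\<in>{1..}. if lower l S p' = lower l S p then min y p else lower l S p')"
proof -
  have "lower l S p' = lower l S p \<longleftrightarrow> p' = p" if "p' \<in> {1..}" for p'
    using strict_mono_on_imp_inj_on[OF strict_mono_on_lower[OF assms(1)]] that assms(2)
    by (auto simp: inj_on_def)
  with assms(2) show ?thesis
    by (auto simp: lower_def fun_eq_iff restrict_def)
qed

lemma upper_upd_same:
  assumes "p \<in> {1..l}" "max y p = max (S p) p"
  shows "upper l (S(p := y)) = upper l S"
  using assms by (auto simp: upper_def fun_eq_iff)

lemma lower_upd_same:
  assumes "p \<in> {1..l}" "min y p = min (S p) p"
  shows "lower l (S(p := y)) = lower l S"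
  using assms by (auto simp: lower_def fun_eq_iff)

text \<open>An entry moves by 1 to a free value, so it cannot pass its neighbours.\<close>

lemma seqs_fin_swap:
  assumes S: "S \<in> seqs_fin l" and p: "p \<in> {1..l}"
    and mv: "movable s i (S ` {1..l})" "S p = entry_from s i"
  shows "S(p := entry_to s i) \<in> seqs_fin l"
    and "S(p := entry_to s i) ` {1..l} = swap s i (S ` {1..l})"
proof -
  have ne: "S p' \<noteq> entry_to s i" if "p' \<in> {1..l}" for p'
    using mv(1) that by (metis imageI movable_def)
  have close: "entry_to s i = S p + 1 \<or> entry_to s i = S p - 1"
    using mv(2) by (cases s) auto
  have "strict_mono_on {1..l} (S(p := entry_to s i))"
  proof (rule strict_mono_onI)
    fix p1 p2 assume *: "p1 \<in> {1..l}" "p2 \<in> {1..l}" "p1 < p2"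
    then have "S p1 < S p2"
      using seqs_finD(2)[OF S] by blast
    with * ne[of p1] ne[of p2] close show "(S(p := entry_to s i)) p1 < (S(p := entry_to s i)) p2"
      by auto
  qed
  with S p show "S(p := entry_to s i) \<in> seqs_fin l"
    by (auto simp: seqs_fin_def extensional_def)
  have "S p' = S p \<longleftrightarrow> p' = p" if "p' \<in> {1..l}" for p'
    using seqs_finD(1)[OF S] that p by (auto simp: inj_on_def)
  then have "(S(p := entry_to s i)) ` {1..l} = insert (entry_to s i) (S ` {1..l} - {S p})"
    using p by (auto simp: image_iff)
  then show "S(p := entry_to s i) ` {1..l} = swap s i (S ` {1..l})"
    by (simp add: swap_def mv(2))
qed

text \<open>
  Since \<open>S p - p\<close> is nondecreasing, there is a threshold \<open>\<alpha>\<close> such that \<open>lower l S\<close> agrees with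
  \<open>S\<close> up to the index \<open>\<alpha>\<close>, and \<open>upper l S\<close> agrees with \<open>S\<close> beyond it.
\<close>

locale split_seq =
  fixes l :: int and S :: iseq and \<alpha> :: int
  assumes S: "S \<in> seqs_fin l"
    and \<alpha>: "0 \<le> \<alpha>" "\<alpha> \<le> l"
    and below: "\<And>p. 1 \<le> p \<Longrightarrow> p \<le> \<alpha> \<Longrightarrow> S p \<le> p"
    and above: "\<And>p. \<alpha> < p \<Longrightarrow> p \<le> l \<Longrightarrow> p < S p"

lemma split_seq_exists:
  assumes S: "S \<in> seqs_fin l" and l: "0 \<le> l"
  shows "\<exists>\<alpha>. split_seq l S \<alpha>"
proof -
  \<comment> \<open>The element 0 covers the case that no index has S p \<le> p.\<close>
  let ?P = "insert 0 {p \<in> {1..l}. S p \<le> p}"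
  define \<alpha> where "\<alpha> = Max ?P"
  have fin: "finite ?P"
    by (rule finite_subset[of _ "{0..l}"]) (use l in auto)
  then have "\<alpha> \<in> ?P"
    unfolding \<alpha>_def by (rule Max_in) simp
  then have \<alpha>: "0 \<le> \<alpha>" "\<alpha> \<le> l" "1 \<le> \<alpha> \<Longrightarrow> S \<alpha> \<le> \<alpha>"
    using l by auto
  have max: "p \<le> \<alpha>" if "p \<in> ?P" for p
    unfolding \<alpha>_def using fin that by (rule Max_ge)
  show ?thesis
  proof (intro exI[of _ \<alpha>] split_seq.intro S \<alpha>(1,2))
    fix p assume p: "1 \<le> p" "p \<le> \<alpha>"
    have "strict_mono_on {1..l} S"
      using S by (simp add: seqs_fin_def)
    then have "S p + (\<alpha> - p) \<le> S \<alpha>"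
      by (rule strict_mono_on_gap) (use p \<alpha>(2) in auto)
    with \<alpha>(3) p show "S p \<le> p" by simp
  next
    fix p assume p: "\<alpha> < p" "p \<le> l"
    then show "p < S p"
      using max[of p] \<alpha>(1) by fastforce
  qed
qed

context split_seq
begin

abbreviation "A \<equiv> S ` {1..l}"
abbreviation "T \<equiv> upper l S"
abbreviation "T' \<equiv> lower l S"

lemma upper_simps:
  "p \<le> \<alpha> \<Longrightarrow> T p = p"
  "\<alpha> < p \<Longrightarrow> p \<le> l \<Longrightarrow> T p = S p"
  using below[of p] above[of p] \<alpha> by (auto simp: upper_def max_def)

lemma lower_simps:
  "1 \<le> p \<Longrightarrow> p \<le> \<alpha> \<Longrightarrow> T' p = S p"
  "1 \<le> p \<Longrightarrow> \<alpha> < p \<Longrightarrow> T' p = p"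
  using below[of p] above[of p] \<alpha> by (auto simp: lower_def min_def)

lemma index_le: "p \<in> {1..l} \<Longrightarrow> S p \<le> \<alpha> \<Longrightarrow> p \<le> \<alpha>"
  using above[of p] by force

lemma index_gt: "p \<in> {1..l} \<Longrightarrow> \<alpha> < S p \<Longrightarrow> \<alpha> < p"
  using below[of p] by force

text \<open>Entries of index at most \<alpha> have values at most \<alpha> and are absorbed by the
  half-line that the diagonal part of T fills.\<close>

lemma in_upper: "x \<in> T ` {..l} \<longleftrightarrow> x \<le> \<alpha> \<or> x \<in> A"
proof
  assume "x \<in> T ` {..l}"
  then obtain p where p: "p \<le> l" "x = T p" by auto
  then show "x \<le> \<alpha> \<or> x \<in> A"
    using \<alpha> by (cases "p \<le> \<alpha>") (auto simp: upper_simps)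
next
  assume *: "x \<le> \<alpha> \<or> x \<in> A"
  show "x \<in> T ` {..l}"
  proof (cases "x \<le> \<alpha>")
    case True
    then show ?thesis
      using \<alpha> upper_simps(1)[of x] by (intro image_eqI[of _ _ x]) auto
  next
    case False
    with * obtain p where p: "p \<in> {1..l}" "x = S p" by auto
    with False index_gt[of p] show ?thesis
      using upper_simps(2)[of p] by (intro image_eqI[of _ _ p]) auto
  qed
qed

lemma in_lower: "x \<in> T' ` {1..} \<longleftrightarrow> \<alpha> < x \<or> x \<in> A"
proof
  assume "x \<in> T' ` {1..}"
  then obtain p where p: "1 \<le> p" "x = T' p" by auto
  then show "\<alpha> < x \<or> x \<in> A"
    using \<alpha> by (cases "p \<le> \<alpha>") (auto simp: lower_simps)
next
  assume *: "\<alpha> < x \<or> x \<in> A"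
  show "x \<in> T' ` {1..}"
  proof (cases "\<alpha> < x")
    case True
    then show ?thesis
      using \<alpha> lower_simps(2)[of x] by (intro image_eqI[of _ _ x]) auto
  next
    case False
    with * obtain p where p: "p \<in> {1..l}" "x = S p" by auto
    with False index_le[of p] show ?thesis
      using lower_simps(1)[of p] by (intro image_eqI[of _ _ p]) auto
  qed
qed

text \<open>A value \<alpha> + 1 would sit at an index above \<alpha>, and there values exceed their
  index.\<close>

lemma gap_notin: "\<alpha> + 1 \<notin> A"
proof
  assume "\<alpha> + 1 \<in> A"
  then obtain p where p: "p \<in> {1..l}" "S p = \<alpha> + 1" by auto
  then show False
    using index_gt[of p] above[of p] by auto
qed

text \<open>The index p of the value \<alpha> is at most \<alpha>; growth by at least 1 per step
  from p to \<alpha>, against S \<alpha> \<le> \<alpha>, forces p = \<alpha>.\<close>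

lemma index_\<alpha>: "\<alpha> \<in> A \<Longrightarrow> 1 \<le> \<alpha> \<and> S \<alpha> = \<alpha>"
proof -
  assume "\<alpha> \<in> A"
  then obtain p where p: "p \<in> {1..l}" "S p = \<alpha>" by auto
  have "p \<le> \<alpha>"
    using index_le[of p] p by simp
  have "strict_mono_on {1..l} S"
    using S by (simp add: seqs_fin_def)
  then have "S p + (\<alpha> - p) \<le> S \<alpha>"
    by (rule strict_mono_on_gap) (use p \<alpha>(2) \<open>p \<le> \<alpha>\<close> in auto)
  then have "p = \<alpha>"
    using below[of \<alpha>] p \<open>p \<le> \<alpha>\<close> by auto
  with p show ?thesis by auto
qed

lemma inj_upper: "inj_on T {..l}"
  by (rule strict_mono_on_imp_inj_on[OF strict_mono_on_upper[OF S]])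

lemma inj_lower: "inj_on T' {1..}"
  by (rule strict_mono_on_imp_inj_on[OF strict_mono_on_lower[OF S]])

lemma spec_from:
  assumes "q \<noteq> 0" "p \<in> {1..l}" "movable s i A" "S p = entry_from s i"
  shows "spec q l a i A = a * q powi (i + l + 1 - 2 * p)"
proof (cases s)
  case Plus
  have "q * spec q l a i A = a * q powi (l + (i + 1) + 1 - 2 * p)"
    using spec_Suc[of A q l a i] spec_index[OF S assms(2), of q a] assms Plus
    by (simp add: movable_simps)
  also have "\<dots> = q * (a * q powi (i + l + 1 - 2 * p))"
    using power_int_add[of q 1 "i + l + 1 - 2 * p"] assms(1) by (simp add: algebra_simps)
  finally show ?thesis
    using assms(1) by simp
next
  case Minus
  then show ?thesis
    using spec_index[OF S assms(2), of q a] assms by (simp add: add.commute)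
qed

lemma fund_phi_upper_\<alpha>:
  "fund_phi \<iota> z q {..l} l a \<alpha> T = psi (\<iota> q) (\<iota> (a * q powi (l + 1 - \<alpha>)) * z)"
proof -
  have "index_of {..l} T \<alpha> = \<alpha>"
    using index_of_eq[OF inj_upper, of \<alpha>] \<alpha> by (simp add: upper_simps)
  moreover have "\<alpha> \<in> T ` {..l}" "\<alpha> + 1 \<notin> T ` {..l}"
    using gap_notin by (simp_all add: in_upper)
  moreover have "\<alpha> + l + 1 - 2 * \<alpha> = l + 1 - \<alpha>"
    by simp
  ultimately show ?thesis
    by (simp only: fund_phi_def if_False if_True simp_thms)
qed

text \<open>The entry \<alpha> + 1 of T' has index \<alpha> + 1, which gives the same argument of
  \<psi> as in \<open>fund_phi_upper_\<alpha>\<close>. If \<alpha> is not in A, the ends of the two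
  half-lines cancel.\<close>

lemma fund_phi_lower_\<alpha>:
  assumes "q \<noteq> 0"
  shows "fund_phi \<iota> z q {1..} 0 (a * q powi l) \<alpha> T' =
    (if \<alpha> \<in> A then 1 else inverse (psi (\<iota> q) (\<iota> (a * q powi (l + 1 - \<alpha>)) * z)))"
proof -
  have "index_of {1..} T' (\<alpha> + 1) = \<alpha> + 1"
    using index_of_eq[OF inj_lower, of "\<alpha> + 1"] \<alpha> by (simp add: lower_simps)
  moreover have "\<alpha> \<in> T' ` {1..} \<longleftrightarrow> \<alpha> \<in> A" "\<alpha> + 1 \<in> T' ` {1..}"
    by (simp_all add: in_lower)
  moreover have "a * q powi l * q powi (\<alpha> + 0 + 3 - 2 * (\<alpha> + 1)) = a * q powi (l + 1 - \<alpha>)"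
    using power_int_add[of q l "\<alpha> + 0 + 3 - 2 * (\<alpha> + 1)"] assms by (simp add: algebra_simps)
  ultimately show ?thesis
    unfolding fund_phi_def by (auto simp: mult.assoc)
qed

lemma fund_phi_far:
  "i < \<alpha> \<Longrightarrow> fund_phi \<iota> z q {..l} l a i T = 1"
  "\<alpha> < i \<Longrightarrow> fund_phi \<iota> z q {1..} 0 b i T' = 1"
  by (rule fund_phi_eq_1; simp add: in_upper in_lower)+

text \<open>Serves both factors where they agree with S on the values i and i + 1: the equation for
  b and N holds for b = a, N = l and for b = a q^l, N = 0.\<close>

lemma fund_phi_index:
  assumes U: "inj_on U D" and iff: "i \<in> U ` D \<longleftrightarrow> i \<in> A" "i + 1 \<in> U ` D \<longleftrightarrow> i + 1 \<in> A"
    and idx: "\<And>p. p \<in> {1..l} \<Longrightarrow> S p = i \<or> S p = i + 1 \<Longrightarrow> p \<in> D \<and> U p = S p"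
    and "q \<noteq> 0" and b: "b * q powi N = a * q powi l"
  shows "fund_phi \<iota> z q D N b i U = eps_phi \<iota> z q (spec q l a i A) (wt_coeff i A)"
proof -
  have c: "b * q powi (k + N + k') = a * q powi (l + k + k')" for k k'
    using b assms(5) by (simp add: power_int_add mult_ac)
  consider "i + 1 \<in> A" "i \<notin> A" | "i \<in> A" "i + 1 \<notin> A" | "i \<in> A \<longleftrightarrow> i + 1 \<in> A" by blast
  then show ?thesis
  proof cases
    case 1
    then obtain p where p: "p \<in> {1..l}" "S p = i + 1" by auto
    have "index_of D U (i + 1) = p"
      using index_of_eq[OF U, of p] idx[OF p(1)] p(2) by simp
    moreover have "b * q powi (i + N + 3 - 2 * p) = spec q l a i A * q ^ 2"
    proof -
      have "b * q powi (i + N + 3 - 2 * p) = a * q powi (2 + (i + l + 1 - 2 * p))"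
        using c[of i "3 - 2 * p"] by (simp add: algebra_simps)
      also have "\<dots> = spec q l a i A * q ^ 2"
        using spec_from[OF assms(5) p(1), of Plus i a] 1 p(2) assms(5)
        by (subst power_int_add) (simp_all add: movable_simps)
      finally show ?thesis .
    qed
    ultimately show ?thesis
      using 1 iff by (simp add: fund_phi_def eps_phi_def wt_coeff_def)
  next
    case 2
    then obtain p where p: "p \<in> {1..l}" "S p = i" by auto
    have "index_of D U i = p"
      using index_of_eq[OF U, of p] idx[OF p(1)] p(2) by simp
    moreover have "b * q powi (i + N + 1 - 2 * p) = spec q l a i A"
      using c[of i "1 - 2 * p"] spec_from[OF assms(5) p(1), of Minus i a] 2 p(2)
      by (simp add: movable_simps algebra_simps)
    ultimately show ?thesis
      using 2 iff by (simp add: fund_phi_def eps_phi_def wt_coeff_def)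
  next
    case 3
    with iff show ?thesis
      by (auto simp: fund_phi_def eps_phi_def wt_coeff_def)
  qed
qed

text \<open>Away from \<alpha> one factor is 1. At \<alpha> the boundary factors must cancel, which
  needs \<psi> to be nonzero; this is true of the expansions, though not of values at
  points.\<close>

lemma tens_phi_eq:
  assumes q0: "q \<noteq> 0" and nz: "\<And>b. psi (\<iota> q) (\<iota> b * z) \<noteq> 0"
  shows "tens_phi \<iota> z q l a i (T, T') = eps_phi \<iota> z q (spec q l a i A) (wt_coeff i A)"
proof -
  consider "i < \<alpha>" | "i = \<alpha>" | "\<alpha> < i" by linarith
  then show ?thesis
  proof cases
    case 1
    have "fund_phi \<iota> z q {1..} 0 (a * q powi l) i T' = eps_phi \<iota> z q (spec q l a i A) (wt_coeff i A)"
      by (rule fund_phi_index[OF inj_lower])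
        (use 1 q0 index_le lower_simps(1) in \<open>auto simp: in_lower\<close>)
    with 1 show ?thesis
      by (simp add: tens_phi_def fund_phi_far)
  next
    case 2
    have "eps_phi \<iota> z q (spec q l a \<alpha> A) (wt_coeff \<alpha> A) =
        (if \<alpha> \<in> A then psi (\<iota> q) (\<iota> (a * q powi (l + 1 - \<alpha>)) * z) else 1)"
      using index_\<alpha> gap_notin spec_index[OF S, of \<alpha> q a] \<alpha>
      by (auto simp: eps_phi_def wt_coeff_def)
    with 2 nz show ?thesis
      by (simp add: tens_phi_def fund_phi_upper_\<alpha> fund_phi_lower_\<alpha>[OF q0])
  next
    case 3
    have "fund_phi \<iota> z q {..l} l a i T = eps_phi \<iota> z q (spec q l a i A) (wt_coeff i A)"
      by (rule fund_phi_index[OF inj_upper])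
        (use 3 q0 index_gt upper_simps(2) in \<open>auto simp: in_upper\<close>)
    with 3 show ?thesis
      by (simp add: tens_phi_def fund_phi_far)
  qed
qed

text \<open>
  For \<open>i \<noteq> \<alpha>\<close> one of the two factors contains both \<open>i\<close> and \<open>i + 1\<close>, so that \<open>x\<^sub>i\<close> vanishes and
  \<open>\<phi>\<^sub>i\<close> is \<open>1\<close> on it. For \<open>i = \<alpha>\<close> the only surviving terms that the finite model lacks are killed
  by a zero of \<open>\<psi>\<close> or \<open>\<psi>\<inverse>\<close> in the coproduct.
\<close>

lemma tens_x_eq:
  assumes q0: "q \<noteq> 0" and a0: "a \<noteq> 0"
  shows "movable s i A \<Longrightarrow> p \<in> {1..l} \<Longrightarrow> S p = entry_from s i \<Longrightarrow>
      tens_x q l a s i r (T, T') = fscale (spec q l a i A powi r)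
        (bvec (upper l (S(p := entry_to s i)), lower l (S(p := entry_to s i))))"
    and "\<not> movable s i A \<Longrightarrow> tens_x q l a s i r (T, T') = 0"
proof -
  have b: "a * q powi l * q powi (i + 0 + 1 - 2 * p) = a * q powi (i + l + 1 - 2 * p)" for p
    using power_int_add[of q l "i + 0 + 1 - 2 * p"] q0 by (simp add: algebra_simps)
  consider "i < \<alpha>" | "i = \<alpha>" | "\<alpha> < i" by linarith
  then have "(movable s i A \<longrightarrow> p \<in> {1..l} \<longrightarrow> S p = entry_from s i \<longrightarrow>
      tens_x q l a s i r (T, T') = fscale (spec q l a i A powi r)
        (bvec (upper l (S(p := entry_to s i)), lower l (S(p := entry_to s i))))) \<and>
    (\<not> movable s i A \<longrightarrow> tens_x q l a s i r (T, T') = 0)"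
  proof cases
    case 1
    have T: "fund_x q {..l} l b g s i r T = 0" for b g
      by (rule fund_x_zero) (use 1 in \<open>cases s; simp add: in_upper\<close>)
    have iff: "entry_from s i \<in> T' ` {1..} \<longleftrightarrow> entry_from s i \<in> A"
      "entry_to s i \<in> T' ` {1..} \<longleftrightarrow> entry_to s i \<in> A"
      using 1 by (cases s; simp add: in_lower)+
    have "fund_x q {1..} 0 (a * q powi l) (\<lambda>z. 1) s i r T' =
        fscale (spec q l a i A powi r) (bvec (lower l (S(p := entry_to s i))))"
      and "upper l (S(p := entry_to s i)) = T"
      if mv: "movable s i A" and p: "p \<in> {1..l}" "S p = entry_from s i"
    proof -
      have "S p \<le> \<alpha>"
        using p(2) 1 by (cases s) auto
      then have "p \<le> \<alpha>"
        using index_le p by blast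
      then have T'p: "T' p = S p" and "S p \<le> p"
        using p(1) lower_simps(1)[of p] below[of p] by auto
      have "entry_to s i \<le> p"
      proof (cases s)
        case Plus
        then show ?thesis
          using p(2) \<open>S p \<le> p\<close> by simp
      next
        case Minus
        \<comment> \<open>The move must not cross the diagonal below \<alpha>. If S i = i there,
          then S (i + 1) is squeezed to i + 1 and the target is occupied.\<close>
        have "p \<noteq> i"
        proof
          assume "p = i"
          with Minus p 1 \<alpha> have "S (i + 1) \<le> i + 1" "S i < S (i + 1)" "S i = i" "i + 1 \<in> {1..l}"
            using below[of "i + 1"] seqs_finD(2)[OF S, of i "i + 1"] by auto
          then have "i + 1 = S (i + 1)"
            by linarith
          with \<open>i + 1 \<in> {1..l}\<close> have "i + 1 \<in> A"
            by blast
          with mv Minus show False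
            by (simp add: movable_simps)
        qed
        with Minus p(2) \<open>S p \<le> p\<close> show ?thesis
          by simp
      qed
      then show "upper l (S(p := entry_to s i)) = T"
        using \<open>S p \<le> p\<close> p(1) by (intro upper_upd_same) auto
      have "p \<in> {1..}"
        using p(1) by simp
      moreover have "entry_to s i \<notin> T' ` {1..}"
        using mv by (simp add: iff movable_def)
      ultimately show "fund_x q {1..} 0 (a * q powi l) (\<lambda>z. 1) s i r T' =
          fscale (spec q l a i A powi r) (bvec (lower l (S(p := entry_to s i))))"
        using fund_x_index[OF inj_lower, of p s i q 0 "a * q powi l" "\<lambda>z. 1" r]
          lower_upd[OF S p(1), of "entry_to s i"] T'p p(2) \<open>entry_to s i \<le> p\<close>
        unfolding b spec_from[OF q0 p(1) mv p(2), of a] by (simp add: min_def cong: if_cong)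
    qed
    moreover have "fund_x q {1..} 0 (a * q powi l) (\<lambda>z. 1) s i r T' = 0" if "\<not> movable s i A"
      by (rule fund_x_zero) (use that iff in \<open>simp add: movable_def\<close>)
    ultimately show ?thesis
      using T by (cases s) (simp_all add: fund_phi_far(1)[OF 1])
  next
    case 2
    have T'_Minus: "fund_x q {1..} 0 b g Minus i r T' = 0" for b g
      by (rule fund_x_zero) (simp add: in_lower 2)
    have T_Plus: "fund_x q {..l} l b g Plus i r T = 0" for b g
      by (rule fund_x_zero) (simp add: in_upper 2)
    have movable: "movable s i A \<longleftrightarrow> s = Minus \<and> \<alpha> \<in> A"
      using 2 gap_notin by (cases s) (auto simp: movable_simps)
    have T'_Plus: "fund_x q {1..} 0 (a * q powi l) (\<lambda>z. fund_phi (\<lambda>c. c) z q {..l} l a i T) Plus i r T' = 0"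
    proof (cases "\<alpha> \<in> A")
      case True
      then show ?thesis
        by (intro fund_x_zero) (simp add: in_lower 2)
    next
      case False
      \<comment> \<open>The parameter of x_i^+ on the end entry \<alpha> + 1 of T', at index
        \<alpha> + 1. The coproduct multiplies this term by \<psi>(q^2) = 0.\<close>
      define c where "c = a * q powi l * q powi (i + 0 + 1 - 2 * (\<alpha> + 1))"
      have "a * q powi (l + 1 - \<alpha>) = c * q ^ 2"
        unfolding c_def b using power_int_add[of q "i + l + 1 - 2 * (\<alpha> + 1)" 2] q0 2
        by (simp add: algebra_simps)
      moreover have "c \<noteq> 0"
        using q0 a0 by (simp add: c_def)
      ultimately have "a * q powi (l + 1 - \<alpha>) * inverse c = q ^ 2"
        by simp
      then have "fund_phi (\<lambda>c. c) (inverse c) q {..l} l a i T = 0"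
        using q0 by (simp add: 2 fund_phi_upper_\<alpha> psi_def power2_eq_square)
      moreover have "fund_x q {1..} 0 (a * q powi l) g Plus i r T' =
          fscale (g (inverse c) * c powi r)
            (bvec (\<lambda>p\<in>{1..}. if T' p = entry_from Plus i then entry_to Plus i else T' p))" for g
        unfolding c_def by (rule fund_x_index[OF inj_lower])
          (use False \<alpha> in \<open>simp_all add: 2 lower_simps in_lower\<close>)
      ultimately show ?thesis
        by simp
    qed
    have T_Minus: "fund_x q {..l} l a (\<lambda>z. fund_phi (\<lambda>c. c) z q {1..} 0 (a * q powi l) i T') Minus i r T =
        (if \<alpha> \<in> A then fscale (spec q l a i A powi r) (bvec (upper l (S(\<alpha> := \<alpha> + 1)))) else 0)"
    proof -
      have T\<alpha>: "T \<alpha> = \<alpha>"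
        by (simp add: upper_simps)
      define c where "c = a * q powi (i + l + 1 - 2 * \<alpha>)"
      have *: "fund_x q {..l} l a g Minus i r T =
          fscale (g (inverse c) * c powi r) 
            (bvec (\<lambda>p\<in>{..l}. if T p = entry_from Minus i then entry_to Minus i else T p))" for g
        unfolding c_def by (rule fund_x_index[OF inj_upper])
          (use \<alpha> gap_notin in \<open>simp_all add: 2 T\<alpha> in_upper\<close>)
      \<comment> \<open>If \<alpha> is not in A, the coproduct evaluates the inverse of \<psi> at
        the pole 1 of \<psi>, where its value is 0.\<close>
      have "a * q powi (l + 1 - \<alpha>) * inverse c = 1"
        using q0 a0 by (simp add: c_def 2 algebra_simps)
      then have \<phi>: "fund_phi (\<lambda>c. c) (inverse c) q {1..} 0 (a * q powi l) i T' = (if \<alpha> \<in> A then 1 else 0)"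
        by (simp add: 2 fund_phi_lower_\<alpha>[OF q0] psi_def)
      show ?thesis
      proof (cases "\<alpha> \<in> A")
        case True
        then have "1 \<le> \<alpha>" "S \<alpha> = \<alpha>"
          using index_\<alpha> by auto
        then have "(\<lambda>p\<in>{..l}. if T p = entry_from Minus i then entry_to Minus i else T p) =
            upper l (S(\<alpha> := \<alpha> + 1))"
          using upper_upd[OF S, of \<alpha> "\<alpha> + 1"] \<alpha> T\<alpha> by (simp add: 2 cong: if_cong)
        moreover have "spec q l a i A = c"
          unfolding c_def by (rule spec_from[OF q0, of \<alpha> Minus])
            (use True \<alpha> 2 gap_notin \<open>1 \<le> \<alpha>\<close> \<open>S \<alpha> = \<alpha>\<close> in \<open>simp_all add: movable_simps\<close>)
        ultimately show ?thesis
          using True unfolding * \<phi> by (simp only: if_True mult_1)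
      next
        case False
        then show ?thesis
          unfolding * \<phi> by simp
      qed
    qed
    \<comment> \<open>The entry at \<alpha> leaves the diagonal upwards: T takes over the new value,
      and T' keeps min (\<alpha> + 1) \<alpha> = \<alpha>.\<close>
    have "S(p := i + 1) = S(\<alpha> := \<alpha> + 1) \<and> lower l (S(\<alpha> := \<alpha> + 1)) = T'"
      if "\<alpha> \<in> A" "p \<in> {1..l}" "S p = i"
    proof
      have "1 \<le> \<alpha>" "S \<alpha> = \<alpha>"
        using index_\<alpha>[OF that(1)] by auto
      then have "p = \<alpha>"
        using seqs_finD(1)[OF S] that 2 \<alpha> by (auto dest: inj_onD)
      with 2 show "S(p := i + 1) = S(\<alpha> := \<alpha> + 1)"
        by simp
      show "lower l (S(\<alpha> := \<alpha> + 1)) = T'"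
        using \<open>1 \<le> \<alpha>\<close> \<open>S \<alpha> = \<alpha>\<close> \<alpha> by (intro lower_upd_same) auto
    qed
    with movable show ?thesis
      by (cases s) (simp_all add: T_Plus T'_Minus T'_Plus T_Minus)
  next
    case 3
    have T': "fund_x q {1..} 0 b g s i r T' = 0" for b g
      by (rule fund_x_zero) (use 3 in \<open>cases s; simp add: in_lower\<close>)
    have iff: "entry_from s i \<in> T ` {..l} \<longleftrightarrow> entry_from s i \<in> A"
      "entry_to s i \<in> T ` {..l} \<longleftrightarrow> entry_to s i \<in> A"
      using 3 by (cases s; simp add: in_upper)+
    have "fund_x q {..l} l a (\<lambda>z. 1) s i r T =
        fscale (spec q l a i A powi r) (bvec (upper l (S(p := entry_to s i))))"
      and "lower l (S(p := entry_to s i)) = T'"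
      if mv: "movable s i A" and p: "p \<in> {1..l}" "S p = entry_from s i"
    proof -
      have "\<alpha> < S p"
        using p(2) 3 by (cases s) auto
      then have "\<alpha> < p"
        using index_gt p by blast
      then have Tp: "T p = S p" and "p < S p"
        using p(1) upper_simps(2)[of p] above[of p] by auto
      then have "p \<le> entry_to s i"
        using p(2) by (cases s) auto
      then show "lower l (S(p := entry_to s i)) = T'"
        using \<open>p < S p\<close> p(1) by (intro lower_upd_same) auto
      have "p \<in> {..l}"
        using p(1) by simp
      moreover have "entry_to s i \<notin> T ` {..l}"
        using mv by (simp add: iff movable_def)
      ultimately show "fund_x q {..l} l a (\<lambda>z. 1) s i r T =
          fscale (spec q l a i A powi r) (bvec (upper l (S(p := entry_to s i))))"
        using fund_x_index[OF inj_upper, of p s i q l a "\<lambda>z. 1" r]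
          upper_upd[OF S p(1), of "entry_to s i"] Tp p(2) \<open>p \<le> entry_to s i\<close>
        unfolding spec_from[OF q0 p(1) mv p(2), of a] by (simp add: max_def cong: if_cong)
    qed
    moreover have "fund_x q {..l} l a (\<lambda>z. 1) s i r T = 0" if "\<not> movable s i A"
      by (rule fund_x_zero) (use that iff in \<open>simp add: movable_def\<close>)
    ultimately show ?thesis
      using T' by (cases s) (simp_all add: fund_phi_far(2)[OF 3])
  qed
  then show "movable s i A \<Longrightarrow> p \<in> {1..l} \<Longrightarrow> S p = entry_from s i \<Longrightarrow>
      tens_x q l a s i r (T, T') = fscale (spec q l a i A powi r)
        (bvec (upper l (S(p := entry_to s i)), lower l (S(p := entry_to s i))))"
    and "\<not> movable s i A \<Longrightarrow> tens_x q l a s i r (T, T') = 0"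
    by blast+
qed

text \<open>The images of T and T' together cover every integer once and A once more; the constant
  part drops out of the differences defining \<open>wt_coeff\<close>.\<close>

lemma fund_wt_eq: "fund_wt {..l} T h + fund_wt {1..} T' h = set_wt A h"
proof -
  have w: "(if i + 1 \<in> B \<and> i \<notin> B then - 1 else if i \<in> B \<and> i + 1 \<notin> B then 1 else 0) =
      (of_int (wt_coeff i B) :: rat)" for i B
    by (auto simp: wt_coeff_def)
  have "wt_coeff i (T ` {..l}) + wt_coeff i (T' ` {1..}) = wt_coeff i A" for i
    using gap_notin by (auto simp: wt_coeff_def in_upper in_lower)
  then show ?thesis
    unfolding fund_wt_def set_wt_def w
    by (simp flip: sum.distrib distrib_left of_int_add)
qed

end

section \<open>Basis of the submodule\<close>

lemma int_Sup_in:
  fixes X :: "int set"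
  assumes "X \<noteq> {}" "bdd_above X"
  shows "Sup X \<in> X"
proof -
  obtain x where x: "x \<in> X"
    using assms(1) by blast
  obtain y where y: "\<And>z. z \<in> X \<Longrightarrow> z \<le> y"
    using assms(2) by (auto simp: bdd_above_def)
  have fin: "finite (X \<inter> {x..})"
    by (rule finite_subset[of _ "{x..y}"]) (use y in auto)
  have ne: "X \<inter> {x..} \<noteq> {}"
    using x by auto
  have Max: "Max (X \<inter> {x..}) \<in> X" "x \<le> Max (X \<inter> {x..})"
    using Max_in[OF fin ne] by auto
  have "z \<le> Max (X \<inter> {x..})" if "z \<in> X" for z
    using Max(2) Max_ge[OF fin, of z] that by (cases "x \<le> z") auto
  then have "Sup X = Max (X \<inter> {x..})"
    by (rule cSup_eq_maximum[OF Max(1)])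
  with Max(1) show ?thesis by simp
qed

lemma int_Inf_in:
  fixes X :: "int set"
  assumes "X \<noteq> {}" "bdd_below X"
  shows "Inf X \<in> X"
proof -
  have "Sup (uminus ` X) \<in> uminus ` X"
    using assms by (intro int_Sup_in) auto
  moreover have "Inf X = - Sup (uminus ` X)"
    by (simp add: Inf_int_def)
  ultimately show ?thesis by auto
qed

lemma upper_in_seqs_plus:
  assumes "S \<in> seqs_fin l"
  shows "upper l S \<in> seqs_plus l"
proof -
  have "\<forall>\<^sub>F p in at_bot. upper l S p = p"
    using eventually_le_at_bot[of "min 0 l"] by eventually_elim (auto simp: upper_def)
  then show ?thesis
    using strict_mono_on_upper[OF assms] by (simp add: seqs_plus_def upper_def)
qed

lemma lower_in_seqs_minus:
  assumes "S \<in> seqs_fin l"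
  shows "lower l S \<in> seqs_minus"
proof -
  have "\<forall>\<^sub>F p in at_top. lower l S p = p"
    using eventually_ge_at_top[of "max 1 (l + 1)"] by eventually_elim (auto simp: lower_def)
  then show ?thesis
    using strict_mono_on_lower[OF assms] by (simp add: seqs_minus_def lower_def)
qed

lemma (in split_seq) beta_le_alpha: "beta_idx T' - 1 \<le> alpha_idx l T"
proof -
  have "\<alpha> \<le> alpha_idx l T"
    unfolding alpha_idx_def using \<alpha>
    by (intro cSup_upper) (auto simp: upper_simps bdd_above_def)
  moreover have "beta_idx T' \<le> \<alpha> + 1"
    unfolding beta_idx_def using \<alpha>
    by (intro cInf_lower) (auto simp: lower_simps bdd_below_def)
  ultimately show ?thesis by simp
qed

text \<open>T p - p is nondecreasing and 0 near minus infinity. Hence it is nonnegative, and 0 up to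
  the last fixed index, which exists by \<open>int_Sup_in\<close>.\<close>

lemma seqs_plus_alpha:
  assumes T: "T \<in> seqs_plus l"
  shows "alpha_idx l T \<le> l"
    and "\<And>p. p \<le> alpha_idx l T \<Longrightarrow> T p = p"
    and "\<And>p. p \<le> l \<Longrightarrow> p \<le> T p"
proof -
  let ?X = "{p. p \<le> l \<and> T p = p}"
  have mono: "strict_mono_on {..l} T" and ev: "\<forall>\<^sub>F p in at_bot. T p = p"
    using T by (simp_all add: seqs_plus_def)
  obtain k where k: "\<And>p. p \<le> k \<Longrightarrow> T p = p"
    using ev by (auto simp: eventually_at_bot_linorder)
  have "min k l \<in> ?X"
    using k by simp
  then have "?X \<noteq> {}" by blast
  then have "Sup ?X \<in> ?X"
    by (intro int_Sup_in) (auto simp: bdd_above_def)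
  then have \<alpha>: "alpha_idx l T \<le> l" "T (alpha_idx l T) = alpha_idx l T"
    by (simp_all add: alpha_idx_def)
  then show "alpha_idx l T \<le> l" by simp
  show ge: "p \<le> T p" if "p \<le> l" for p
  proof -
    have "T (min k p) + (p - min k p) \<le> T p"
      by (rule strict_mono_on_gap[OF mono]) (use that in auto)
    with k[of "min k p"] show ?thesis by simp
  qed
  show "T p = p" if "p \<le> alpha_idx l T" for p
  proof -
    have "T p + (alpha_idx l T - p) \<le> T (alpha_idx l T)"
      by (rule strict_mono_on_gap[OF mono]) (use that \<alpha> in auto)
    with ge[of p] that \<alpha> show ?thesis by simp
  qed
qed

lemma seqs_minus_beta:
  assumes T: "T \<in> seqs_minus"
  shows "1 \<le> beta_idx T"
    and "\<And>p. beta_idx T \<le> p \<Longrightarrow> T p = p"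
    and "\<And>p. 1 \<le> p \<Longrightarrow> T p \<le> p"
proof -
  let ?X = "{p. 1 \<le> p \<and> T p = p}"
  have mono: "strict_mono_on {1..} T" and ev: "\<forall>\<^sub>F p in at_top. T p = p"
    using T by (simp_all add: seqs_minus_def)
  obtain k where k: "\<And>p. k \<le> p \<Longrightarrow> T p = p"
    using ev by (auto simp: eventually_at_top_linorder)
  have "max k 1 \<in> ?X"
    using k by simp
  then have "?X \<noteq> {}" by blast
  then have "Inf ?X \<in> ?X"
    by (intro int_Inf_in) (auto simp: bdd_below_def)
  then have \<beta>: "1 \<le> beta_idx T" "T (beta_idx T) = beta_idx T"
    by (simp_all add: beta_idx_def)
  then show "1 \<le> beta_idx T" by simp
  show le: "T p \<le> p" if "1 \<le> p" for p
  proof -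
    have "T p + (max k p - p) \<le> T (max k p)"
      by (rule strict_mono_on_gap[OF mono]) (use that in auto)
    with k[of "max k p"] show ?thesis by simp
  qed
  show "T p = p" if "beta_idx T \<le> p" for p
  proof -
    have "T (beta_idx T) + (p - beta_idx T) \<le> T p"
      by (rule strict_mono_on_gap[OF mono]) (use that \<beta> in auto)
    with le[of p] that \<beta> show ?thesis by simp
  qed
qed

lemma tensor_basis_eq:
  assumes l: "0 \<le> l"
  shows "{(T, T') | T T'. T \<in> seqs_plus l \<and> T' \<in> seqs_minus \<and> alpha_idx l T \<ge> beta_idx T' - 1} =
    (\<lambda>S. (upper l S, lower l S)) ` seqs_fin l"
proof (intro equalityI subsetI)
  fix B assume "B \<in> (\<lambda>S. (upper l S, lower l S)) ` seqs_fin l"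
  then obtain S where S: "S \<in> seqs_fin l" "B = (upper l S, lower l S)" by auto
  obtain \<alpha> where "split_seq l S \<alpha>"
    using split_seq_exists[OF S(1) l] by blast
  with S show "B \<in> {(T, T') | T T'. T \<in> seqs_plus l \<and> T' \<in> seqs_minus \<and> alpha_idx l T \<ge> beta_idx T' - 1}"
    using split_seq.beta_le_alpha upper_in_seqs_plus lower_in_seqs_minus by auto
next
  fix B assume "B \<in> {(T, T') | T T'. T \<in> seqs_plus l \<and> T' \<in> seqs_minus \<and> alpha_idx l T \<ge> beta_idx T' - 1}"
  then obtain T T' where B: "B = (T, T')" and T: "T \<in> seqs_plus l" and T': "T' \<in> seqs_minus"
    and le: "beta_idx T' - 1 \<le> alpha_idx l T"
    by auto
  define \<alpha> where "\<alpha> = alpha_idx l T"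
  note \<alpha> = seqs_plus_alpha[OF T, folded \<alpha>_def]
  note \<beta> = seqs_minus_beta[OF T']
  have T'_id: "T' p = p" if "\<alpha> < p" for p
    using \<beta>(2)[of p] le that by (simp add: \<alpha>_def)
  have \<alpha>0: "0 \<le> \<alpha>"
    using \<beta>(1) le by (simp add: \<alpha>_def)
  \<comment> \<open>At each index one of T p, T' p equals p, so this picks out the other.\<close>
  define S where "S = (\<lambda>p\<in>{1..l}. T p + T' p - p)"
  have S: "S p = T' p" if "1 \<le> p" "p \<le> \<alpha>" for p
    using that \<alpha>(1) \<alpha>(2)[of p] by (simp add: S_def)
  have S': "S p = T p" if "\<alpha> < p" "p \<le> l" for p
    using that \<alpha>0 T'_id[of p] by (simp add: S_def)
  have "strict_mono_on {1..l} S"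
  proof (rule strict_mono_onI)
    fix p p' assume *: "p \<in> {1..l}" "p' \<in> {1..l}" "p < p'"
    \<comment> \<open>T is strictly increasing and T' p - p nondecreasing, so the sum is strictly
      increasing.\<close>
    have "T p < T p'"
      using T * by (auto simp: seqs_plus_def intro: strict_mono_onD)
    moreover have "T' p + (p' - p) \<le> T' p'"
      by (rule strict_mono_on_gap[of "{1..}"]) (use T' * in \<open>auto simp: seqs_minus_def\<close>)
    ultimately show "S p < S p'"
      using * by (simp add: S_def)
  qed
  then have "S \<in> seqs_fin l"
    by (simp add: seqs_fin_def S_def)
  moreover have "upper l S = T"
  proof (rule extensionalityI[of _ "{..l}"])
    fix p assume "p \<in> {..l}"
    then show "upper l S p = T p"
      using S[of p] S'[of p] \<alpha>(2,3)[of p] \<beta>(3)[of p] \<alpha>0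
      by (cases "p \<le> \<alpha>") (auto simp: upper_def)
  qed (use T in \<open>auto simp: upper_def seqs_plus_def\<close>)
  moreover have "lower l S = T'"
  proof (rule extensionalityI[of _ "{1..}"])
    fix p :: int assume "p \<in> {1..}"
    then show "lower l S p = T' p"
      using S[of p] S'[of p] \<alpha>(1) \<alpha>(3)[of p] \<beta>(3)[of p] T'_id[of p]
      by (cases "p \<le> \<alpha>") (auto simp: lower_def)
  qed (use T' in \<open>auto simp: lower_def seqs_minus_def\<close>)
  ultimately show "B \<in> (\<lambda>S. (upper l S, lower l S)) ` seqs_fin l"
    using B by auto
qed

section \<open>The submodule as an instance of the model\<close>

definition tensor_vec :: "int \<Rightarrow> int set \<Rightarrow> (iseq \<times> iseq) \<Rightarrow>\<^sub>0 complex" where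
  "tensor_vec l A =
     (let S = the_inv_into (seqs_fin l) (\<lambda>S. S ` {1..l}) A in bvec (upper l S, lower l S))"

lemma tensor_vec_image:
  assumes "S \<in> seqs_fin l"
  shows "tensor_vec l (S ` {1..l}) = bvec (upper l S, lower l S)"
proof -
  have "inj_on (\<lambda>S. S ` {1..l}) (seqs_fin l)"
    by (rule inj_onI) (rule seqs_fin_image_inj)
  from the_inv_into_f_f[OF this assms] show ?thesis
    by (simp add: tensor_vec_def)
qed

lemma wedge_model_V_YY:
  fixes t a :: complex and l :: int
  assumes root: "\<forall>n::nat. n \<ge> 1 \<longrightarrow> exp t ^ n \<noteq> 1" and a0: "a \<noteq> 0" and l: "l \<ge> 1"
  shows "wedge_model fscale t (V_YY t l a) l a (tensor_vec l) ((\<lambda>S. S ` {1..l}) ` seqs_fin l)"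
    (is "wedge_model _ _ _ _ _ _ ?I")
proof -
  have e_image: "tensor_vec l ` ?I = bvec ` (\<lambda>S. (upper l S, lower l S)) ` seqs_fin l"
    by (auto simp: tensor_vec_image image_image intro!: image_cong)
  have split: "\<exists>\<alpha>. split_seq l S \<alpha>" if "S \<in> seqs_fin l" for S
    using split_seq_exists[OF that] l by simp
  show ?thesis
  proof (intro wedge_model.intro uq_rep.intro fs.vector_space_axioms wedge_model_axioms.intro)
    show "exp t ^ n \<noteq> 1" if "n \<ge> 1" for n :: nat
      using root that by blast
    show "a \<noteq> 0" by fact
    show "fs.independent (tensor_vec l ` ?I)"
      unfolding e_image by (rule independent_bvec)
    show "inj_on (tensor_vec l) ?I"
    proof (rule inj_onI)
      fix A B assume "A \<in> ?I" "B \<in> ?I" and eq: "tensor_vec l A = tensor_vec l B"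
      then obtain S S' where "S \<in> seqs_fin l" "A = S ` {1..l}" "S' \<in> seqs_fin l" "B = S' ` {1..l}"
        by auto
      with eq show "A = B"
        using upper_lower_inj[of S l S'] by (simp add: tensor_vec_image)
    qed
    show "finite A" if "A \<in> ?I" for A
      using that by auto
    show "swap s i A \<in> ?I" if A: "A \<in> ?I" "movable s i A" for s i A
    proof -
      obtain S where S: "S \<in> seqs_fin l" "A = S ` {1..l}"
        using A(1) by auto
      moreover obtain p where "p \<in> {1..l}" "S p = entry_from s i"
        using A(2) S(2) unfolding movable_def by force
      ultimately show ?thesis
        using seqs_fin_swap[of S l p s i] A(2) by (metis imageI)
    qed
    have "Vsp (V_YY t l a) = fs.span (bvec ` {(T, T') | T T'. T \<in> seqs_plus l \<and> T' \<in> seqs_minus \<and>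
        alpha_idx l T \<ge> beta_idx T' - 1})"
      unfolding V_YY_def by (auto intro!: arg_cong[of _ _ fs.span])
    then show "Vsp (V_YY t l a) = fs.span (tensor_vec l ` ?I)"
      unfolding tensor_basis_eq[OF order_trans[OF zero_le_one l]] e_image .
    show "module_hom fscale fscale (Xop (V_YY t l a) s i r)" for s i r
      by (simp add: V_YY_def tensor_module_def lin_ext_hom)
    show "module_hom fscale fscale (Kop (V_YY t l a) h)" for h
      by (simp add: V_YY_def tensor_module_def lin_ext_hom)
    show "module_hom fscale fscale (Hop (V_YY t l a) i m)" for i m
      by (simp add: V_YY_def tensor_module_def lin_ext_hom)
    fix A assume "A \<in> ?I"
    then obtain S where S: "S \<in> seqs_fin l" and A: "A = S ` {1..l}" by auto
    obtain \<alpha> where "split_seq l S \<alpha>"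
      using split[OF S] by blast
    \<comment> \<open>The threshold \<alpha> depends on S, hence one interpretation per basis
      vector.\<close>
    then interpret split_seq l S \<alpha> .
    show "Xop (V_YY t l a) s i r (tensor_vec l A) =
        (if movable s i A then fscale (spec (exp t) l a i A powi r) (tensor_vec l (swap s i A)) else 0)"
      for s i r
    proof (cases "movable s i A")
      case True
      then obtain p where p: "p \<in> {1..l}" "S p = entry_from s i"
        unfolding A movable_def by force
      with True S show ?thesis
        using tens_x_eq(1)[of "exp t" a s i p r] seqs_fin_swap[of S l p s i]
          tensor_vec_image[of "S(p := entry_to s i)" l] a0
        by (simp add: V_YY_def tensor_module_def A tensor_vec_image)
    next
      case False
      with S show ?thesis
        using tens_x_eq(2)[of "exp t" a s i r] a0
        by (simp add: V_YY_def tensor_module_def A tensor_vec_image)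
    qed
    show "Kop (V_YY t l a) h (tensor_vec l A) = fscale (qpow t (set_wt A h)) (tensor_vec l A)" for h
      using S by (simp add: V_YY_def tensor_module_def A tensor_vec_image flip: qpow_add fund_wt_eq)
    show "Hop (V_YY t l a) i m (tensor_vec l A) =
        fscale (h_eigenvalue (exp t) (\<lambda>s. eps_phi fls_const (zvar s) (exp t)
          (spec (exp t) l a i A) (wt_coeff i A)) m) (tensor_vec l A)" for i m
      using S tens_phi_eq[of "exp t" fls_const "zvar _" a i, OF _ psi_zvar_nonzero]
      by (simp add: V_YY_def tensor_module_def A tensor_vec_image)
  qed
qed

theorem proposition3p8:
  fixes t a :: complex and l :: int
  assumes "\<forall>n::nat. n \<ge> 1 \<longrightarrow> exp t ^ n \<noteq> 1"
    and "a \<noteq> 0"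
    and "l \<ge> 1"
  shows "uq_module fscale t (V_YY t l a) \<and>
         uq_rep.thin fscale (V_YY t l a) \<and>
         uq_rep.qchar fscale t (V_YY t l a) = formal_sum (seqs_fin l) (mT (exp t) l a)"
proof -
  interpret wedge_model fscale t "V_YY t l a" l a "tensor_vec l" "(\<lambda>S. S ` {1..l}) ` seqs_fin l"
    using assms by (rule wedge_model_V_YY)
  have lw: "fls_nth (lweight fls_const (zvar s) (exp t) (mT (exp t) l a S) i) (int n) =
      phi_coeff (exp t) s (wt_coeff i (S ` {1..l})) (c i (S ` {1..l})) (sg s * int n)"
    if "S \<in> seqs_fin l" for S s i n
    using wt_coeff_cases[of i "S ` {1..l}"]
    by (subst lweight_mT[OF that]; (subst eps_phi_fls)?) auto
  \<comment> \<open>Among monomials with nonzero parameters, m_S is the only one whose l-weight is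
    that of the basis vector of S.\<close>
  have match: "(\<forall>s i n. fls_nth (lweight fls_const (zvar s) (exp t) m i) (int n) =
      phi_coeff (exp t) s (wt_coeff i (S ` {1..l})) (c i (S ` {1..l})) (sg s * int n)) \<longleftrightarrow>
      mT (exp t) l a S = m" if "S \<in> seqs_fin l" "m \<in> ymonoms" for S m
  proof
    assume *: "\<forall>s i n. fls_nth (lweight fls_const (zvar s) (exp t) m i) (int n) =
      phi_coeff (exp t) s (wt_coeff i (S ` {1..l})) (c i (S ` {1..l})) (sg s * int n)"
    have "mT (exp t) l a S \<in> ymonoms"
      using assms(2) by (simp add: mT_in_ymonoms)
    then show "mT (exp t) l a S = m"
      by (rule lweight_inj[of "exp t", rotated 2])
        (use that assms(1) * lw[OF that(1), of Plus] in \<open>simp_all del: zvar.simps\<close>)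
  qed (use lw[OF that(1)] in blast)
  \<comment> \<open>Distinct sequences have distinct monomials, so the coefficients of the formal
    sum are 0 or 1, like the dimensions in \<open>edim_gen_eigenspace\<close>.\<close>
  have uniq: "S = S'" if "S \<in> seqs_fin l" "S' \<in> seqs_fin l" "mT (exp t) l a S = mT (exp t) l a S'" for S S'
  proof -
    have "S ` {1..l} = S' ` {1..l}"
      using that lw[OF that(1), of Plus _ 0] lw[OF that(2), of Plus _ 0]
      by (intro phi_coeff_determines_set) auto
    with that show ?thesis
      using seqs_fin_image_inj by blast
  qed
  have "qchar m = formal_sum (seqs_fin l) (mT (exp t) l a) m" for m
  proof (cases "\<exists>S \<in> seqs_fin l. mT (exp t) l a S = m")
    case True
    then obtain S where S: "S \<in> seqs_fin l" "mT (exp t) l a S = m" by blast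
    then have "{S' \<in> seqs_fin l. mT (exp t) l a S' = m} = {S}"
      using uniq by blast
    moreover have "m \<in> ymonoms"
      using S(2) assms(2) by (auto simp: mT_in_ymonoms)
    moreover have "\<exists>A \<in> (\<lambda>S. S ` {1..l}) ` seqs_fin l. \<forall>s i n.
        fls_nth (lweight fls_const (zvar s) (exp t) m i) (int n) =
        phi_coeff (exp t) s (wt_coeff i A) (c i A) (sg s * int n)"
      using S match[OF S(1) \<open>m \<in> ymonoms\<close>] by (intro bexI[OF _ imageI[OF S(1)]]) simp
    ultimately show ?thesis
      unfolding qchar_def formal_sum_def edim_gen_eigenspace
      by (auto simp: one_enat_def)
  next
    case False
    then have "{S' \<in> seqs_fin l. mT (exp t) l a S' = m} = {}"
      by blast
    then have "formal_sum (seqs_fin l) (mT (exp t) l a) m = 0"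
      unfolding formal_sum_def by (simp only:) (simp add: zero_enat_def)
    moreover have "qchar m = 0"
      using False match unfolding qchar_def edim_gen_eigenspace by auto
    ultimately show ?thesis by simp
  qed
  then show ?thesis
    using uq_module thin by blast
qed

end
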